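(* Let $\Sigma$ be a compact surface and let $\pi$ be the Poisson structure on $\Sigma$ constructed in the context. Then every neighborhood of the identity in $\mathrm{Poiss}(\Sigma,\pi)$ (with the $C^\infty$-topology) intersects an uncountable number of path-connected components of $\mathrm{Poiss}(\Sigma,\pi)$.
   Context: For a Poisson manifold $(M,\pi)$, $\mathrm{Poiss}(M,\pi)=\{\phi\in \mathrm{Diff}(M) : \phi_*(\pi)=\pi\}$, with the $C^\infty$-topology inherited from $\mathrm{Diff}(M)$. In dimension two any smooth bivector field is a Poisson structure. Construction of $\pi$. Let $\Sigma$ be a compact surface. Fix a closed disk $B\subset\Sigma$ contained in a coordinate chart $x=(x_1,x_2)$ which identifies $B$ with the closed disk of radius $1$ around $0$ in $\mathbb{R}^2=\mathbb{C}$. Fix a smooth function $\chi:\mathbb{R}\to[0,1]$ with $\chi(t)=0$ for $|t|\ge 1$, $\chi(t)>0$ for $1/2<|t|<1$, and $\chi(t)=1$ for $|t|\le 1/2$. For $p\in\mathbb{R}^2$ and $\delta>0$ let $$\pi_{p,\delta}(x):=\chi\left(\frac{|x-p|}{\delta}\right)\partial_{x_1}\wedge\partial_{x_2}.$$ For integers $n\ge 4$ and $1\le s\le 2^n$ let $$p(n,s):=\frac1n\exp\left(\frac{2\pi s}{2^n}i\right),\qquad \delta_n:=\frac{1}{n2^n},\qquad \pi_n:=\frac{1}{n!}\sum_{s=1}^{2^n}\pi_{p(n,s),\delta_n}$$ (in the formula for $p(n,s)$, $\pi$ is the number and $i$ the imaginary unit). The series $\sum_n\pi_n$ converges uniformly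 on $B$ together with all derivatives, and $\pi$ is the smooth bivector field on $\Sigma$ given by $$\pi|_B=\sum_{n=4}^\infty\pi_n,\qquad \pi|_{\Sigma\setminus B}=0.$$ *)

theory Defs
  imports "HOL-Analysis.Analysis"
begin

section \<open>Smooth functions between Euclidean spaces\<close>

text \<open>
  Iterated partial derivatives, in the directions of a list of (basis) vectors; the head of the list
  is the direction of the last differentiation.
\<close>

definition iter_deriv ::
    "'m::euclidean_space list \<Rightarrow> ('m \<Rightarrow> 'b::real_normed_vector) \<Rightarrow> 'm \<Rightarrow> 'b" where
  "iter_deriv vs f = foldr (\<lambda>v g x. frechet_derivative g (at x) v) vs f"

text \<open>
  This is \<open>C\<^sup>\<infinity>\<close> on \<open>U\<close> for open \<open>U\<close>, the only case used: all iterated partial derivatives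
  exist and are (totally) differentiable, hence continuous, at all points of \<open>U\<close>.
\<close>

definition smooth_on ::
    "'m::euclidean_space set \<Rightarrow> ('m \<Rightarrow> 'b::real_normed_vector) \<Rightarrow> bool" where
  "smooth_on U f \<longleftrightarrow>
     (\<forall>vs. set vs \<subseteq> Basis \<longrightarrow> (\<forall>x\<in>U. iter_deriv vs f differentiable (at x)))"

section \<open>Smooth surfaces\<close>

text \<open>
  A chart is a pair of its domain and its coordinate map; the values of the coordinate map outside
  of the domain are irrelevant.  The underlying topological space of a surface is a type of class
  \<^class>\<open>t2_space\<close>.
\<close>

type_synonym 'a chart = "'a set \<times> ('a \<Rightarrow> real^2)"

definition is_chart :: "('a::t2_space) chart \<Rightarrow> bool" where
  "is_chart c \<longleftrightarrow> open (fst c) \<and> open (snd c ` fst c) \<and>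
     homeomorphism (fst c) (snd c ` fst c) (snd c) (inv_into (fst c) (snd c))"

text \<open>
  The local representative \<open>d \<circ> f \<circ> c\<^sup>-\<^sup>1\<close> of \<open>f\<close>, meaningful on
  \<open>rep_dom c d f\<close>.
\<close>

definition rep :: "'a chart \<Rightarrow> 'a chart \<Rightarrow> ('a \<Rightarrow> 'a) \<Rightarrow> real^2 \<Rightarrow> real^2" where
  "rep c d f = snd d \<circ> f \<circ> inv_into (fst c) (snd c)"

definition rep_dom :: "'a chart \<Rightarrow> 'a chart \<Rightarrow> ('a \<Rightarrow> 'a) \<Rightarrow> (real^2) set" where
  "rep_dom c d f = snd c ` (fst c \<inter> f -` fst d)"

definition compatible :: "'a chart \<Rightarrow> 'a chart \<Rightarrow> bool" where
  "compatible c d \<longleftrightarrow> smooth_on (rep_dom c d id) (rep c d id) \<and>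
                     smooth_on (rep_dom d c id) (rep d c id)"

text \<open>A smooth structure is a maximal smooth atlas.\<close>

definition smooth_structure :: "('a::t2_space) chart set \<Rightarrow> bool" where
  "smooth_structure A \<longleftrightarrow>
     (\<forall>c\<in>A. is_chart c) \<and> (\<Union>c\<in>A. fst c) = UNIV \<and>
     (\<forall>c\<in>A. \<forall>d\<in>A. compatible c d) \<and>
     (\<forall>c. is_chart c \<and> (\<forall>d\<in>A. compatible c d) \<longrightarrow> c \<in> A)"

text \<open>
  A compact surface is a compact Hausdorff space with a smooth structure modelled on the plane.  It
  has no boundary; second countability follows from compactness.
\<close>

definition compact_surface :: "('a::t2_space) chart set \<Rightarrow> bool" where
  "compact_surface A \<longleftrightarrow> compact (UNIV :: 'a set) \<and> smooth_structure A"

section \<open>Diffeomorphisms and the \<open>C\<^sup>\<infinity>\<close>-topology\<close>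

definition smooth_map :: "('a::t2_space) chart set \<Rightarrow> ('a \<Rightarrow> 'a) \<Rightarrow> bool" where
  "smooth_map A f \<longleftrightarrow> continuous_on UNIV f \<and>
     (\<forall>c\<in>A. \<forall>d\<in>A. smooth_on (rep_dom c d f) (rep c d f))"

definition Diff :: "('a::t2_space) chart set \<Rightarrow> ('a \<Rightarrow> 'a) set" where
  "Diff A = {f. bij f \<and> smooth_map A f \<and> smooth_map A (inv f)}"

text \<open>
  The standard subbasic sets of the \<open>C\<^sup>\<infinity>\<close>-topology: maps whose local representatives are
  \<open>e\<close>-close to those of \<open>f\<close> over the compact set \<open>K\<close>, with all partial derivatives up to
  order \<open>r\<close>.
\<close>

definition Cinf_subbasic ::
    "('a::t2_space) chart set \<Rightarrow> nat \<Rightarrow> ('a \<Rightarrow> 'a) \<Rightarrow> 'a chart \<Rightarrow> 'a chart \<Rightarrow> 'a set \<Rightarrow> real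
      \<Rightarrow> ('a \<Rightarrow> 'a) set" where
  "Cinf_subbasic A r f c d K e =
     {g. smooth_map A g \<and> g ` K \<subseteq> fst d \<and>
         (\<forall>vs. set vs \<subseteq> Basis \<and> length vs \<le> r \<longrightarrow>
            (\<forall>x \<in> snd c ` K. norm (iter_deriv vs (rep c d g) x - iter_deriv vs (rep c d f) x) < e))}"

definition Cinf_topology :: "('a::t2_space) chart set \<Rightarrow> ('a \<Rightarrow> 'a) topology" where
  "Cinf_topology A = topology_generated_by
     {Cinf_subbasic A r f c d K e | r f c d K e.
        smooth_map A f \<and> c \<in> A \<and> d \<in> A \<and> compact K \<and> K \<subseteq> fst c \<and> f ` K \<subseteq> fst d \<and> e > 0}"

section \<open>Bivector fields and Poisson diffeomorphisms\<close>

text \<open>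
  A (not necessarily smooth) bivector field \<open>P\<close> on a surface is represented by its coefficients: in the chart \<open>c\<close> with
  coordinates \<open>x\<^sub>1, x\<^sub>2\<close>, it is \<open>P c p\<close> times \<open>\<partial>\<^sub>x\<^sub>1 \<and> \<partial>\<^sub>x\<^sub>2\<close> at the point \<open>p\<close>.  Under a
  change of coordinates \<open>\<partial>\<^sub>x\<^sub>1 \<and> \<partial>\<^sub>x\<^sub>2\<close> is multiplied by the Jacobian determinant.  The value
  is \<open>0\<close> where there is no coefficient, so that equality of bivector fields is \<open>=\<close>.
\<close>

type_synonym 'a bivector = "'a chart \<Rightarrow> 'a \<Rightarrow> real"

definition jac_det :: "(real^2 \<Rightarrow> real^2) \<Rightarrow> real^2 \<Rightarrow> real" where
  "jac_det F x = det (jacobian F (at x))"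

definition bivector_field :: "'a chart set \<Rightarrow> 'a bivector \<Rightarrow> bool" where
  "bivector_field A P \<longleftrightarrow>
     (\<forall>c\<in>A. \<forall>d\<in>A. \<forall>p\<in>fst c \<inter> fst d. P d p = jac_det (rep c d id) (snd c p) * P c p) \<and>
     (\<forall>c p. \<not> (c \<in> A \<and> p \<in> fst c) \<longrightarrow> P c p = 0)"

text \<open>
  The value of \<open>\<phi>\<^sub>*P\<close> at \<open>q\<close> is the image of the value of \<open>P\<close> at
  \<open>p = \<phi>\<^sup>-\<^sup>1(q)\<close> under \<open>\<And>\<^sup>2 d\<phi>\<close>; it does not depend on the chart \<open>c\<close> at \<open>p\<close> used to
  compute it, see \<open>pushforward_eq\<close> below.
\<close>

definition pushforward ::
    "'a chart set \<Rightarrow> ('a \<Rightarrow> 'a) \<Rightarrow> 'a bivector \<Rightarrow> 'a bivector" where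
  "pushforward A \<phi> P = (\<lambda>d q.
     if d \<in> A \<and> q \<in> fst d
     then let p = inv \<phi> q; c = (SOME c. c \<in> A \<and> p \<in> fst c)
          in jac_det (rep c d \<phi>) (snd c p) * P c p
     else 0)"

definition Poiss :: "('a::t2_space) chart set \<Rightarrow> 'a bivector \<Rightarrow> ('a \<Rightarrow> 'a) set" where
  "Poiss A P = {\<phi> \<in> Diff A. pushforward A \<phi> P = P}"

definition Poiss_topology ::
    "('a::t2_space) chart set \<Rightarrow> 'a bivector \<Rightarrow> ('a \<Rightarrow> 'a) topology" where
  "Poiss_topology A P = subtopology (Cinf_topology A) (Poiss A P)"

section \<open>The Poisson structure\<close>

definition plane_of_complex :: "complex \<Rightarrow> real^2" where
  "plane_of_complex z = vector [Re z, Im z]"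

definition pt :: "nat \<Rightarrow> nat \<Rightarrow> real^2" where
  "pt n s = plane_of_complex (1 / of_nat n * exp (2 * of_real pi * of_nat s / 2 ^ n * \<i>))"

definition rad :: "nat \<Rightarrow> real" where
  "rad n = 1 / (real n * 2 ^ n)"

text \<open>In the plane, bivector fields are identified with their coefficients in the standard
  coordinates.\<close>

definition disc_coeff :: "(real \<Rightarrow> real) \<Rightarrow> real^2 \<Rightarrow> real \<Rightarrow> real^2 \<Rightarrow> real" where
  "disc_coeff chi p \<delta> x = chi (norm (x - p) / \<delta>)"

definition ring_coeff :: "(real \<Rightarrow> real) \<Rightarrow> nat \<Rightarrow> real^2 \<Rightarrow> real" where
  "ring_coeff chi n x = 1 / fact n * (\<Sum>s = 1..2 ^ n. disc_coeff chi (pt n s) (rad n) x)"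

definition disk_coeff :: "(real \<Rightarrow> real) \<Rightarrow> real^2 \<Rightarrow> real" where
  "disk_coeff chi x = (\<Sum>n. ring_coeff chi (n + 4) x)"

definition chart_disk :: "'a chart \<Rightarrow> 'a set" where
  "chart_disk c = {p \<in> fst c. snd c p \<in> cball 0 1}"

text \<open>
  The bivector field with coefficient \<open>disk_coeff chi\<close> in the chart \<open>c0\<close> on the disk
  \<open>chart_disk c0\<close>, and vanishing outside of that disk.
\<close>

definition poisson_bivector ::
    "'a chart set \<Rightarrow> 'a chart \<Rightarrow> (real \<Rightarrow> real) \<Rightarrow> 'a bivector" where
  "poisson_bivector A c0 chi = (\<lambda>c p.
     if c \<in> A \<and> p \<in> fst c \<and> p \<in> chart_disk c0
     then jac_det (rep c0 c id) (snd c0 p) * disk_coeff chi (snd c0 p)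
     else 0)"

section \<open>Independence of the choice of charts\<close>

lemma smooth_on_differentiable: "smooth_on U f \<Longrightarrow> x \<in> U \<Longrightarrow> f differentiable (at x)"
  unfolding smooth_on_def by (metis empty_subsetI foldr_Nil id_apply iter_deriv_def list.set(1))

lemma is_chart_inv: "is_chart c \<Longrightarrow> p \<in> fst c \<Longrightarrow> inv_into (fst c) (snd c) (snd c p) = p"
  by (auto simp: is_chart_def homeomorphism_def)

lemma open_rep_dom:
  assumes "is_chart c" "open (fst d)" "continuous_on UNIV f"
  shows "open (rep_dom c d f)"
proof -
  have "open (fst c \<inter> f -` fst d)"
    using assms by (auto simp: is_chart_def intro!: open_Int open_vimage)
  then have "openin (top_of_set (snd c ` fst c)) (snd c ` (fst c \<inter> f -` fst d))"
    using assms(1) unfolding is_chart_def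
    by (meson homeomorphism_imp_open_map inf_le1 openin_open_eq openin_subset_trans)
  then show ?thesis
    using assms(1) unfolding is_chart_def rep_dom_def by (meson openin_open_trans)
qed

lemma jac_det_comp:
  assumes c: "is_chart c" and d: "is_chart d" and f: "continuous_on UNIV f"
    and p: "p \<in> fst c" "f p \<in> fst d"
    and df: "rep c d f differentiable (at (snd c p))"
    and dg: "rep d e g differentiable (at (snd d (f p)))"
  shows "jac_det (rep c e (g \<circ> f)) (snd c p) =
         jac_det (rep d e g) (snd d (f p)) * jac_det (rep c d f) (snd c p)"
proof -
  let ?x = "snd c p"
  have x: "rep c d f ?x = snd d (f p)"
    by (simp add: rep_def is_chart_inv[OF c p(1)])
  have S: "open (rep_dom c d f)" "?x \<in> rep_dom c d f"
    using open_rep_dom[OF c _ f] d p by (auto simp: is_chart_def rep_dom_def)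
  have eq: "(rep d e g \<circ> rep c d f) y = rep c e (g \<circ> f) y" if "y \<in> rep_dom c d f" for y
    using that by (auto simp: rep_dom_def rep_def is_chart_inv[OF c] is_chart_inv[OF d])
  have diff: "(rep d e g \<circ> rep c d f) differentiable (at ?x)"
    using df dg x by (intro differentiable_chain_at) auto
  have "frechet_derivative (rep c e (g \<circ> f)) (at ?x) =
        frechet_derivative (rep d e g \<circ> rep c d f) (at ?x)"
    by (metis frechet_derivative_transform_within_open[where g = "rep c e (g \<circ> f)", OF diff S] eq)
  also have "\<dots> = frechet_derivative (rep d e g) (at (snd d (f p))) \<circ> frechet_derivative (rep c d f) (at ?x)"
    using frechet_derivative_compose[of "rep c d f" ?x "rep d e g"] df dg x by simp
  finally show ?thesis
    unfolding jac_det_def jacobian_def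
    by (simp only: matrix_compose[OF linear_frechet_derivative[OF df] linear_frechet_derivative[OF dg]]
        det_mul)
qed

lemma bivector_field_poisson_bivector:
  assumes A: "smooth_structure A" and c0: "c0 \<in> A"
  shows "bivector_field A (poisson_bivector A c0 chi)"
  unfolding bivector_field_def
proof (intro conjI ballI allI impI)
  fix c d p assume c: "c \<in> A" and d: "d \<in> A" and p: "p \<in> fst c \<inter> fst d"
  have diff: "rep a b id differentiable (at (snd a p))"
    if "a \<in> A" "b \<in> A" "p \<in> fst a" "p \<in> fst b" for a b
    using A that unfolding smooth_structure_def compatible_def
    by (auto intro!: smooth_on_differentiable simp: rep_dom_def)
  have "jac_det (rep c0 d (id \<circ> id)) (snd c0 p) =
        jac_det (rep c d id) (snd c (id p)) * jac_det (rep c0 c id) (snd c0 p)" if "p \<in> fst c0"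
  proof (rule jac_det_comp)
    show "rep c0 c id differentiable (at (snd c0 p))"
      using diff c c0 p that by blast
    show "rep c d id differentiable (at (snd c (id p)))"
      using diff c d p by simp
  qed (use A c c0 p that in \<open>auto simp: smooth_structure_def\<close>)
  then show "poisson_bivector A c0 chi d p =
      jac_det (rep c d id) (snd c p) * poisson_bivector A c0 chi c p"
    using c d p by (auto simp: poisson_bivector_def chart_disk_def)
qed (auto simp: poisson_bivector_def)

lemma pushforward_eq:
  assumes A: "smooth_structure A" and P: "bivector_field A P" and \<phi>: "\<phi> \<in> Diff A"
    and c: "c \<in> A" and d: "d \<in> A" and p: "p \<in> fst c" "\<phi> p \<in> fst d"
  shows "pushforward A \<phi> P d (\<phi> p) = jac_det (rep c d \<phi>) (snd c p) * P c p"
proof -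
  define b where "b = (SOME b. b \<in> A \<and> p \<in> fst b)"
  have "b \<in> A \<and> p \<in> fst b"
    unfolding b_def by (rule someI[of _ c]) (use c p in simp)
  then have b: "b \<in> A" "p \<in> fst b"
    by auto
  have inv: "inv \<phi> (\<phi> p) = p"
    using \<phi> by (simp add: Diff_def bij_is_inj)
  have "jac_det (rep c d (\<phi> \<circ> id)) (snd c p) =
        jac_det (rep b d \<phi>) (snd b (id p)) * jac_det (rep c b id) (snd c p)"
  proof (rule jac_det_comp)
    show "rep c b id differentiable (at (snd c p))"
      using A c b p unfolding smooth_structure_def compatible_def
      by (auto intro!: smooth_on_differentiable simp: rep_dom_def)
    show "rep b d \<phi> differentiable (at (snd b (id p)))"
      using \<phi> b d p unfolding Diff_def smooth_map_def
      by (auto intro!: smooth_on_differentiable simp: rep_dom_def)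
  qed (use A b c p in \<open>auto simp: smooth_structure_def\<close>)
  moreover have "P b p = jac_det (rep c b id) (snd c p) * P c p"
    using P b c p(1) unfolding bivector_field_def by blast
  moreover have "pushforward A \<phi> P d (\<phi> p) = jac_det (rep b d \<phi>) (snd b p) * P b p"
    using d p(2) unfolding pushforward_def Let_def inv b_def by (simp only: if_True simp_thms)
  ultimately show ?thesis
    by simp
qed

end

theory Submission
  imports Defs
begin

text \<open>
  For a set \<open>S\<close> of indices \<open>n \<ge> 5\<close>, let \<open>\<phi>\<^sub>S\<close> rotate the disk around its center, by an angle
  depending only on the radius: by \<open>2\<pi>/2\<^sup>n\<close> on the \<open>n\<close>-th ring for \<open>n \<in> S\<close>, and by \<open>0\<close> on and
  around the other rings.  Such a map preserves area and permutes the disks of every ring, so it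
  preserves \<open>\<pi>\<close>.  It is smooth at the center because \<open>2\<^sup>-\<^sup>n\<close> decays faster than any power of the
  radius \<open>1/n\<close>.

  Every Poisson diffeomorphism preserves the set where \<open>\<pi>\<close> does not vanish.  Hence along a path of
  Poisson diffeomorphisms the image of the center of a disk stays in one and the same disk.  For
  \<open>n \<in> S - T\<close>, \<open>\<phi>\<^sub>S\<close> moves \<open>p(n, 1)\<close> to \<open>p(n, 2)\<close> while \<open>\<phi>\<^sub>T\<close> fixes it, so \<open>\<phi>\<^sub>S\<close> and \<open>\<phi>\<^sub>T\<close> lie in
  different path components.

  If \<open>S\<close> contains only large indices, then \<open>\<phi>\<^sub>S\<close> is close to the identity, uniformly in \<open>S\<close>: near
  every point other than the center it agrees with the identity or with the single smooth map
  \<open>\<phi>\<^sub>T\<close>, \<open>T = {5, 6, \<dots>}\<close>, and all derivatives of \<open>\<phi>\<^sub>T\<close> at the center are those of the identity.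
\<close>

section \<open>Calculus of smooth functions\<close>

text \<open>Order zero already means total differentiability, so all orders together give exactly
  \<open>smooth_on\<close>. The recursion differentiates \<open>f\<close> first, which lets closure
  properties be proved by induction on the order with \<open>f\<close> arbitrary.\<close>

primrec Ck :: "nat \<Rightarrow> 'm::euclidean_space set \<Rightarrow> ('m \<Rightarrow> 'b::real_normed_vector) \<Rightarrow> bool" where
  "Ck 0 U f \<longleftrightarrow> (\<forall>x\<in>U. f differentiable (at x))"
| "Ck (Suc k) U f \<longleftrightarrow> (\<forall>x\<in>U. f differentiable (at x)) \<and>
     (\<forall>v\<in>Basis. Ck k U (\<lambda>x. frechet_derivative f (at x) v))"

lemma iter_deriv_Nil [simp]: "iter_deriv [] f = f"
  by (simp add: iter_deriv_def)

lemma iter_deriv_Cons: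
  "iter_deriv (v # vs) f = (\<lambda>x. frechet_derivative (iter_deriv vs f) (at x) v)"
  by (simp add: iter_deriv_def)

lemma iter_deriv_snoc:
  "iter_deriv (vs @ [v]) f = iter_deriv vs (\<lambda>x. frechet_derivative f (at x) v)"
  by (simp add: iter_deriv_def)

text \<open>The recursion of \<open>Ck\<close> strips the innermost differentiation, which is the
  last entry of the list of directions; hence the lists are taken apart from their end.\<close>

lemma Ck_iff:
  "Ck k U f \<longleftrightarrow> (\<forall>vs. set vs \<subseteq> Basis \<and> length vs \<le> k \<longrightarrow>
     (\<forall>x\<in>U. iter_deriv vs f differentiable (at x)))"
proof (induction k arbitrary: f)
  case (Suc k)
  show ?case
  proof
    assume *: "Ck (Suc k) U f"
    show "\<forall>vs. set vs \<subseteq> Basis \<and> length vs \<le> Suc k \<longrightarrow> (\<forall>x\<in>U. iter_deriv vs f differentiable (at x))"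
    proof (intro allI impI)
      fix vs :: "'a list" assume vs: "set vs \<subseteq> Basis \<and> length vs \<le> Suc k"
      show "\<forall>x\<in>U. iter_deriv vs f differentiable (at x)"
      proof (cases vs rule: rev_cases)
        case Nil
        then show ?thesis using * by simp
      next
        case (snoc ws v)
        then show ?thesis using * vs Suc.IH[of "\<lambda>x. frechet_derivative f (at x) v"]
          by (auto simp: iter_deriv_snoc)
      qed
    qed
  next
    assume *: "\<forall>vs. set vs \<subseteq> Basis \<and> length vs \<le> Suc k \<longrightarrow> (\<forall>x\<in>U. iter_deriv vs f differentiable (at x))"
    have "Ck k U (\<lambda>x. frechet_derivative f (at x) v)" if "v \<in> Basis" for v
      unfolding Suc.IH iter_deriv_snoc[symmetric] using * that by auto
    moreover have "\<forall>x\<in>U. f differentiable (at x)"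
      using *[rule_format, of "[]"] by simp
    ultimately show "Ck (Suc k) U f" by simp
  qed
qed simp

lemma smooth_on_iff_Ck: "smooth_on U f \<longleftrightarrow> (\<forall>k. Ck k U f)"
  unfolding smooth_on_def Ck_iff by blast

lemma Ck_Suc_imp: "Ck (Suc k) U f \<Longrightarrow> Ck k U f"
  unfolding Ck_iff by auto

lemma iter_deriv_cong:
  assumes "open U" "\<And>x. x \<in> U \<Longrightarrow> f x = g x" "x \<in> U"
  shows "iter_deriv vs f x = iter_deriv vs g x"
  using assms(3)
proof (induction vs arbitrary: x)
  case (Cons v vs)
  have "frechet_derivative (iter_deriv vs f) (at x) = frechet_derivative (iter_deriv vs g) (at x)"
  proof -
    \<comment> \<open>\<open>frechet_derivative\<close> is a choice among all derivatives
      \<open>D\<close>. The two predicates agree for every \<open>D\<close>, so the choices agree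
      whether or not a derivative exists.\<close>
    have "(iter_deriv vs f has_derivative D) (at x) \<longleftrightarrow> (iter_deriv vs g has_derivative D) (at x)" for D
      using Cons has_derivative_transform_within_open[OF _ assms(1) Cons.prems]
      by metis
    then show ?thesis unfolding frechet_derivative_def by simp
  qed
  then show ?case by (simp add: iter_deriv_Cons)
qed (use assms in simp)

lemma differentiable_cong_open:
  assumes "f differentiable (at x)" "open U" "x \<in> U" "\<And>y. y \<in> U \<Longrightarrow> f y = g y"
  shows "g differentiable (at x)"
proof -
  from assms(1) obtain D where "(f has_derivative D) (at x)"
    unfolding differentiable_def by blast
  then have "(g has_derivative D) (at x)"
    by (rule has_derivative_transform_within_open) (use assms in auto)
  then show ?thesis unfolding differentiable_def by blast
qed

lemma iter_deriv_differentiable_cong: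
  assumes "open U" "\<And>x. x \<in> U \<Longrightarrow> f x = g x" "x \<in> U" "iter_deriv vs f differentiable (at x)"
  shows "iter_deriv vs g differentiable (at x)"
  using assms(4,1,3) by (rule differentiable_cong_open) (rule iter_deriv_cong[OF assms(1,2)])

lemma smooth_on_cong:
  assumes "smooth_on U f" "open U" "\<And>x. x \<in> U \<Longrightarrow> f x = g x"
  shows "smooth_on U g"
  using assms(1) iter_deriv_differentiable_cong[of U f g, OF assms(2,3)] unfolding smooth_on_def
  by blast

lemma smooth_on_subset: "smooth_on U f \<Longrightarrow> V \<subseteq> U \<Longrightarrow> smooth_on V f"
  by (auto simp: smooth_on_def)

lemma smooth_on_local:
  assumes "\<And>x. x \<in> U \<Longrightarrow> \<exists>V. x \<in> V \<and> smooth_on V f"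
  shows "smooth_on U f"
  using assms unfolding smooth_on_def by blast

lemma Ck_cong:
  assumes "Ck k U f" "open U" "\<And>x. x \<in> U \<Longrightarrow> f x = g x"
  shows "Ck k U g"
  using assms(1) iter_deriv_differentiable_cong[of U f g, OF assms(2,3)] unfolding Ck_iff by blast

lemma continuous_iter_deriv:
  assumes "smooth_on U f" "set vs \<subseteq> Basis" "x \<in> U"
  shows "isCont (iter_deriv vs f) x"
  using assms unfolding smooth_on_def by (auto intro: differentiable_imp_continuous_within)

section \<open>Closure properties of differentiable functions of finite order\<close>

lemma Ck_const: "Ck k U (\<lambda>x. c)"
  by (induction k arbitrary: c) auto

lemma Ck_bounded_linear:
  assumes L: "bounded_linear L" and "open U" "Ck k U f"
  shows "Ck k U (\<lambda>x. L (f x))"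
  using assms(3)
proof (induction k arbitrary: f)
  case (Suc k)
  have d: "((\<lambda>x. L (f x)) has_derivative (\<lambda>v. L (frechet_derivative f (at x) v))) (at x)"
    if "x \<in> U" for x
    by (rule bounded_linear.has_derivative[OF L])
      (use Suc.prems that in \<open>auto simp: frechet_derivative_works[symmetric]\<close>)
  have "Ck k U (\<lambda>x. frechet_derivative (\<lambda>x. L (f x)) (at x) v)" if "v \<in> Basis" for v
    by (rule Ck_cong[of _ _ "\<lambda>x. L (frechet_derivative f (at x) v)"])
      (use Suc that frechet_derivative_at[OF d] \<open>open U\<close> in \<open>auto dest: fun_cong\<close>)
  then show ?case using d by (auto simp: differentiable_def)
qed (auto simp: differentiable_def intro: bounded_linear.has_derivative[OF L])

lemma Ck_add:
  assumes "open U" "Ck k U f" "Ck k U g"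
  shows "Ck k U (\<lambda>x. f x + g x)"
  using assms(2,3)
proof (induction k arbitrary: f g)
  case (Suc k)
  have d: "((\<lambda>x. f x + g x) has_derivative
      (\<lambda>v. frechet_derivative f (at x) v + frechet_derivative g (at x) v)) (at x)"
    if "x \<in> U" for x
    using Suc.prems that by (auto intro!: derivative_intros simp: frechet_derivative_works)
  have "Ck k U (\<lambda>x. frechet_derivative (\<lambda>x. f x + g x) (at x) v)" if "v \<in> Basis" for v
    by (rule Ck_cong[of _ _ "\<lambda>x. frechet_derivative f (at x) v + frechet_derivative g (at x) v"])
      (use Suc that frechet_derivative_at[OF d] \<open>open U\<close> in \<open>auto dest: fun_cong\<close>)
  then show ?case using d by (auto simp: differentiable_def)
qed auto

lemma Ck_sum:
  assumes "open U" "finite I" "\<And>i. i \<in> I \<Longrightarrow> Ck k U (f i)"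
  shows "Ck k U (\<lambda>x. \<Sum>i\<in>I. f i x)"
  using assms(2,3) by (induction I rule: finite_induct) (auto intro: Ck_const Ck_add[OF assms(1)])

lemma Ck_scaleR:
  fixes f :: "'m::euclidean_space \<Rightarrow> real"
  assumes "open U" "Ck k U f" "Ck k U g"
  shows "Ck k U (\<lambda>x. f x *\<^sub>R g x)"
  using assms(2,3)
proof (induction k arbitrary: f g)
  case (Suc k)
  have d: "((\<lambda>x. f x *\<^sub>R g x) has_derivative
      (\<lambda>v. f x *\<^sub>R frechet_derivative g (at x) v + frechet_derivative f (at x) v *\<^sub>R g x)) (at x)"
    if "x \<in> U" for x
    using Suc.prems that by (auto intro!: derivative_intros simp: frechet_derivative_works)
  have "Ck k U (\<lambda>x. frechet_derivative (\<lambda>x. f x *\<^sub>R g x) (at x) v)" if "v \<in> Basis" for v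
  proof (rule Ck_cong)
    show "Ck k U (\<lambda>x. f x *\<^sub>R frechet_derivative g (at x) v + frechet_derivative f (at x) v *\<^sub>R g x)"
      using Suc.prems that
      by (intro Ck_add Suc.IH) (auto simp: \<open>open U\<close> intro: Ck_Suc_imp)
  qed (use frechet_derivative_at[OF d] \<open>open U\<close> in \<open>auto dest: fun_cong\<close>)
  then show ?case using d by (auto simp: differentiable_def)
qed (auto intro!: derivative_intros)

lemma Ck_compose:
  fixes f :: "'n::euclidean_space \<Rightarrow> 'b::real_normed_vector" and g :: "'m::euclidean_space \<Rightarrow> 'n"
  assumes "open U" "open V" "g ` U \<subseteq> V" "Ck k V f" "Ck k U g"
  shows "Ck k U (\<lambda>x. f (g x))"
  using assms(4,5)
proof (induction k arbitrary: f)
  case 0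
  then show ?case using assms(3)
    by (auto intro!: differentiable_compose[of f g] simp: image_subset_iff)
next
  case (Suc k)
  \<comment> \<open>The chain rule expanded in the basis: components of the derivative of
    \<open>g\<close> times partial derivatives of \<open>f\<close> composed with \<open>g\<close>.
    The induction hypothesis applies to the latter factors.\<close>
  let ?D = "\<lambda>x v. \<Sum>i\<in>Basis. (frechet_derivative g (at x) v \<bullet> i) *\<^sub>R frechet_derivative f (at (g x)) i"
  have d: "((\<lambda>x. f (g x)) has_derivative ?D x) (at x)" if "x \<in> U" for x
  proof -
    have f': "(f has_derivative frechet_derivative f (at (g x))) (at (g x))"
      using Suc.prems that assms(3) by (auto simp: frechet_derivative_works)
    have "((\<lambda>x. f (g x)) has_derivative (\<lambda>v. frechet_derivative f (at (g x)) (frechet_derivative g (at x) v))) (at x)"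
      by (rule has_derivative_compose[of g _ x UNIV f, OF _ f'])
        (use Suc.prems that in \<open>auto simp: frechet_derivative_works[symmetric]\<close>)
    also have "(\<lambda>v. frechet_derivative f (at (g x)) (frechet_derivative g (at x) v)) = ?D x"
    proof
      fix v
      interpret linear "frechet_derivative f (at (g x))"
        using f' by (rule has_derivative_linear)
      show "frechet_derivative f (at (g x)) (frechet_derivative g (at x) v) = ?D x v"
        by (subst euclidean_representation[symmetric]) (simp add: sum scaleR)
    qed
    finally show ?thesis .
  qed
  have "Ck k U (\<lambda>x. frechet_derivative (\<lambda>x. f (g x)) (at x) v)" if "v \<in> Basis" for v
  proof (rule Ck_cong)
    show "Ck k U (\<lambda>x. ?D x v)"
      using Suc.prems that
      by (intro Ck_sum Ck_scaleR Suc.IH Ck_bounded_linear[where L = "\<lambda>y. y \<bullet> i" for i])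
        (auto simp: \<open>open U\<close> intro: Ck_Suc_imp bounded_linear_inner_left)
  qed (use frechet_derivative_at[OF d] \<open>open U\<close> in \<open>auto dest: fun_cong\<close>)
  then show ?case using d by (auto simp: differentiable_def)
qed

lemma smooth_on_add: "open U \<Longrightarrow> smooth_on U f \<Longrightarrow> smooth_on U g \<Longrightarrow> smooth_on U (\<lambda>x. f x + g x)"
  by (auto simp: smooth_on_iff_Ck intro: Ck_add)

lemma smooth_on_scaleR:
  "open U \<Longrightarrow> smooth_on U f \<Longrightarrow> smooth_on U g \<Longrightarrow> smooth_on U (\<lambda>x. f x *\<^sub>R g x)"
  by (auto simp: smooth_on_iff_Ck intro: Ck_scaleR)

lemma smooth_on_compose:
  "open U \<Longrightarrow> open V \<Longrightarrow> g ` U \<subseteq> V \<Longrightarrow> smooth_on V f \<Longrightarrow> smooth_on U g \<Longrightarrow>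
    smooth_on U (\<lambda>x. f (g x))"
  unfolding smooth_on_iff_Ck using Ck_compose by blast

lemma smooth_on_bounded_linear:
  assumes "bounded_linear L" "open U"
  shows "smooth_on U L"
proof -
  have d: "(L has_derivative L) (at x)" for x
    by (rule bounded_linear_imp_has_derivative[OF assms(1)])
  have "Ck k U L" for k
    by (cases k) (use d frechet_derivative_at[OF d, symmetric] in \<open>auto simp: differentiable_def Ck_const\<close>)
  then show ?thesis by (simp add: smooth_on_iff_Ck)
qed

text \<open>The only basis vector of the reals is 1, so a list of directions matters only through
  its length.\<close>

lemma iter_deriv_real:
  fixes f :: "real \<Rightarrow> real"
  assumes "F 0 = f" "\<And>k x. (F k has_real_derivative F (Suc k) x) (at x)" "set vs \<subseteq> Basis"
  shows "iter_deriv vs f = F (length vs)"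
  using assms(3)
proof (induction vs)
  case (Cons v vs)
  have "frechet_derivative (F (length vs)) (at x) = (\<lambda>h. F (Suc (length vs)) x * h)" for x
    using assms(2)[of "length vs" x] unfolding has_field_derivative_def
    by (rule frechet_derivative_at[symmetric])
  then show ?case using Cons by (auto simp: iter_deriv_Cons)
qed (use assms in simp)

lemma smooth_on_real_seq:
  fixes f :: "real \<Rightarrow> real"
  assumes "F 0 = f" "\<And>k x. (F k has_real_derivative F (Suc k) x) (at x)"
  shows "smooth_on UNIV f"
  unfolding smooth_on_def using iter_deriv_real[OF assms] assms(2)
  by (auto intro!: differentiableI simp: has_field_derivative_def)

lemma smooth_on_real_derivs:
  fixes f :: "real \<Rightarrow> real"
  assumes "smooth_on UNIV f"
  shows "(iter_deriv (replicate k 1) f has_real_derivative iter_deriv (replicate (Suc k) 1) f x) (at x)"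
proof -
  have "iter_deriv (replicate k 1) f differentiable (at x)"
    using assms unfolding smooth_on_def by (auto simp: set_replicate_conv_if)
  then have *: "(iter_deriv (replicate k 1) f has_derivative
      frechet_derivative (iter_deriv (replicate k 1) f) (at x)) (at x)"
    by (simp add: frechet_derivative_works)
  \<comment> \<open>A linear map on the reals is multiplication by its value at 1.\<close>
  have "frechet_derivative (iter_deriv (replicate k 1) f) (at x) h =
      iter_deriv (replicate (Suc k) 1) f x * h" for h
    using linear_cmul[OF has_derivative_linear[OF *], of h 1] by (simp add: iter_deriv_Cons)
  then show ?thesis
    using * unfolding has_field_derivative_def by presburger
qed

lemma smooth_on_imp_continuous_on: "smooth_on U f \<Longrightarrow> continuous_on U f"
  by (rule differentiable_imp_continuous_on)
    (simp add: differentiable_on_def differentiable_at_withinI smooth_on_differentiable)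

text \<open>Each differentiation advances the argument by a quarter period, which gives all
  derivatives in closed form.\<close>

lemma smooth_on_cos: "smooth_on UNIV (cos :: real \<Rightarrow> real)"
proof (rule smooth_on_real_seq[where F = "\<lambda>k x. cos (x + real k * (pi / 2))"])
  fix k and x :: real
  have "cos (x + real (Suc k) * (pi / 2)) = cos ((x + real k * (pi / 2)) + pi / 2)"
    by (simp add: distrib_right add_ac add_divide_distrib)
  also have "\<dots> = - sin (x + real k * (pi / 2))"
    by (simp only: cos_add) simp
  finally have e: "cos (x + real (Suc k) * (pi / 2)) = - sin (x + real k * (pi / 2))" .
  show "((\<lambda>x. cos (x + real k * (pi / 2))) has_real_derivative cos (x + real (Suc k) * (pi / 2))) (at x)"
    unfolding e by (rule derivative_eq_intros refl | simp)+
qed simp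

lemma smooth_on_sin: "smooth_on UNIV (sin :: real \<Rightarrow> real)"
proof (rule smooth_on_real_seq[where F = "\<lambda>k x. sin (x + real k * (pi / 2))"])
  fix k and x :: real
  have "sin (x + real (Suc k) * (pi / 2)) = sin ((x + real k * (pi / 2)) + pi / 2)"
    by (simp add: distrib_right add_ac add_divide_distrib)
  also have "\<dots> = cos (x + real k * (pi / 2))"
    by (simp only: sin_add) simp
  finally have e: "sin (x + real (Suc k) * (pi / 2)) = cos (x + real k * (pi / 2))" .
  show "((\<lambda>x. sin (x + real k * (pi / 2))) has_real_derivative sin (x + real (Suc k) * (pi / 2))) (at x)"
    unfolding e by (rule derivative_eq_intros refl | simp)+
qed simp

section \<open>The rotation angle\<close>

locale cutoff =
  fixes chi :: "real \<Rightarrow> real"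
  assumes chi_smooth: "smooth_on UNIV chi"
    and chi_range: "\<And>t. chi t \<in> {0..1}"
    and chi_zero: "\<And>t. \<bar>t\<bar> \<ge> 1 \<Longrightarrow> chi t = 0"
    and chi_one: "\<And>t. \<bar>t\<bar> \<le> 1/2 \<Longrightarrow> chi t = 1"
begin

definition dchi :: "nat \<Rightarrow> real \<Rightarrow> real" where
  "dchi k = iter_deriv (replicate k 1) chi"

lemma dchi_0 [simp]: "dchi 0 = chi"
  by (simp add: dchi_def)

lemma dchi_deriv: "(dchi k has_real_derivative dchi (Suc k) x) (at x)"
  unfolding dchi_def by (rule smooth_on_real_derivs[OF chi_smooth])

text \<open>On the open set of all \<open>t\<close> with \<open>\<bar>t\<bar> > 1\<close> the
  function \<open>chi\<close> coincides with the zero function, and derivatives are local.\<close>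

lemma dchi_zero:
  assumes "\<bar>t\<bar> > 1"
  shows "dchi k t = 0"
proof -
  have "dchi k t = iter_deriv (replicate k 1) (\<lambda>_. 0) t"
    unfolding dchi_def
  proof (rule iter_deriv_cong)
    show "open ({..< -1} \<union> {1<..} :: real set)" by auto
  qed (use assms chi_zero in auto)
  also have "\<dots> = 0"
    by (subst iter_deriv_real[where F = "\<lambda>_ _. 0"]) (auto simp: set_replicate_conv_if)
  finally show ?thesis .
qed

lemma dchi_bounded:
  obtains M where "M \<ge> 0" "\<And>t. \<bar>dchi k t\<bar> \<le> M"
proof -
  have "continuous_on {-1..1} (dchi k)"
    by (rule continuous_at_imp_continuous_on) (meson DERIV_isCont dchi_deriv)
  then have "compact (dchi k ` {-1..1})"
    by (intro compact_continuous_image) auto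
  then obtain M where M: "\<And>y. y \<in> dchi k ` {-1..1} \<Longrightarrow> norm y \<le> M"
    using compact_imp_bounded bounded_iff by metis
  have "\<bar>dchi k t\<bar> \<le> \<bar>M\<bar>" for t
    using M[of "dchi k t"] dchi_zero[of t k] by (cases "\<bar>t\<bar> > 1") force+
  then show ?thesis using that[of "\<bar>M\<bar>"] by auto
qed

text \<open>
  In the variable \<open>t = 1/|x|\<^sup>2\<close> the \<open>n\<close>-th ring lies close to \<open>n\<^sup>2\<close>, for \<open>n \<ge> 5\<close> within distance
  \<open>2\<close>.  There the bump takes the value \<open>2\<pi>/2\<^sup>n\<close>, the angle between neighbouring disks of the ring;
  the bumps of different rings \<open>n \<ge> 5\<close> have disjoint supports.
\<close>

definition bump :: "nat \<Rightarrow> nat \<Rightarrow> real \<Rightarrow> real" where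
  "bump n k t = 2 * pi / 2 ^ n * (1/4) ^ k * dchi k ((t - real n ^ 2) / 4)"

text \<open>The index \<open>k\<close> is the order of the derivative, here and in
  \<open>bump\<close>, where the factor \<open>(1/4) ^ k\<close> comes from the chain rule. For
  \<open>S \<subseteq> {5..}\<close> at most one term of the series is nonzero at any
  \<open>t\<close>.\<close>

definition bumps :: "nat set \<Rightarrow> nat \<Rightarrow> real \<Rightarrow> real" where
  "bumps S k t = (\<Sum>n. if n \<in> S then bump n k t else 0)"

lemma bump_zero: "\<bar>t - real n ^ 2\<bar> > 4 \<Longrightarrow> bump n k t = 0"
  unfolding bump_def by (subst dchi_zero) (auto simp: abs_divide)

lemma bump_deriv: "(bump n k has_real_derivative bump n (Suc k) t) (at t)"
proof -
  have "((\<lambda>t. dchi k ((t - real n ^ 2) / 4)) has_real_derivative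
      dchi (Suc k) ((t - real n ^ 2) / 4) * (1/4)) (at t)"
    by (rule DERIV_chain2[OF dchi_deriv]) (auto intro!: derivative_eq_intros)
  from DERIV_cmult[OF this, of "2 * pi / 2 ^ n * (1/4) ^ k"] show ?thesis
    by (simp add: bump_def[abs_def] mult_ac)
qed

text \<open>Consecutive squares differ by \<open>2 * n + 1\<close>, at least 11 from
  \<open>n = 5\<close> on. This exceeds 8, the width of the support of a bump.\<close>

lemma square_gap:
  fixes m n :: nat
  assumes "5 \<le> n" "n < m"
  shows "real m ^ 2 - real n ^ 2 \<ge> 11"
proof -
  have "real m ^ 2 \<ge> (real n + 1) ^ 2"
    by (rule power_mono) (use assms in auto)
  then show ?thesis using assms by (simp add: power2_sum)
qed

text \<open>The bound 11/2 is half of the minimal gap, so at most one square is closer to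
  \<open>t\<close> than that. If none is, any \<open>n\<close> serves.\<close>

lemma near_square:
  obtains n :: nat where "\<And>m. 5 \<le> m \<Longrightarrow> m \<noteq> n \<Longrightarrow> \<bar>t - real m ^ 2\<bar> \<ge> 11/2"
proof (cases "\<exists>n\<ge>5. \<bar>t - real n ^ 2\<bar> < 11/2")
  case True
  then obtain n where n: "5 \<le> n" "\<bar>t - real n ^ 2\<bar> < 11/2" by auto
  have "\<bar>t - real m ^ 2\<bar> \<ge> 11/2" if "5 \<le> m" "m \<noteq> n" for m
    using square_gap[of n m] square_gap[of m n] that n by (cases "m < n") (auto simp: not_less_iff_gr_or_eq abs_if split: if_splits)
  then show ?thesis using that by blast
next
  case False
  then show ?thesis using that by force
qed

lemma bumps_eq:
  assumes "S \<subseteq> {5..}" "\<And>m. 5 \<le> m \<Longrightarrow> m \<noteq> n \<Longrightarrow> \<bar>t - real m ^ 2\<bar> > 4"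
  shows "bumps S k t = (if n \<in> S then bump n k t else 0)"
  unfolding bumps_def using assms
  by (subst suminf_finite[of "{n}"]) (auto intro: bump_zero)

lemma bumps_eq_zero:
  assumes "S \<subseteq> {5..}" "\<And>m. m \<in> S \<Longrightarrow> \<bar>t - real m ^ 2\<bar> > 4"
  shows "bumps S k t = 0"
  unfolding bumps_def using assms
  by (subst suminf_finite[of "{}"]) (auto intro: bump_zero)

text \<open>Moving \<open>t\<close> by less than 1 keeps its distance from all other squares above
  11/2 - 1 > 4. The same \<open>n\<close> serves for all sets \<open>T\<close> and all orders
  \<open>k\<close>, which is needed for differentiating and for comparing different sets.\<close>

lemma bumps_local:
  obtains n where "\<And>t T k. \<bar>t - t0\<bar> < 1 \<Longrightarrow> T \<subseteq> {5..} \<Longrightarrow> bumps T k t = (if n \<in> T then bump n k t else 0)"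
proof -
  obtain n where n: "\<And>m. 5 \<le> m \<Longrightarrow> m \<noteq> n \<Longrightarrow> \<bar>t0 - real m ^ 2\<bar> \<ge> 11/2"
    using near_square by blast
  have "bumps T k t = (if n \<in> T then bump n k t else 0)" if t: "\<bar>t - t0\<bar> < 1" "T \<subseteq> {5..}" for t T k
  proof (rule bumps_eq)
    fix m :: nat assume "5 \<le> m" "m \<noteq> n"
    from n[OF this] t show "4 < \<bar>t - (real m)\<^sup>2\<bar>" by linarith
  qed (use t in auto)
  then show ?thesis using that by blast
qed

lemma bumps_deriv:
  assumes S: "S \<subseteq> {5..}"
  shows "(bumps S k has_real_derivative bumps S (Suc k) t) (at t)"
proof -
  obtain n where n: "\<And>s T k. \<bar>s - t\<bar> < 1 \<Longrightarrow> T \<subseteq> {5..} \<Longrightarrow> bumps T k s = (if n \<in> T then bump n k s else 0)"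
    using bumps_local by blast
  have "((\<lambda>s. if n \<in> S then bump n k s else 0) has_real_derivative bumps S (Suc k) t) (at t)"
    using n[of t S "Suc k"] S bump_deriv by auto
  then show ?thesis
    by (rule has_field_derivative_transform_within_open[of _ _ _ "ball t 1"])
      (use n S in \<open>auto simp: dist_real_def abs_minus_commute\<close>)
qed

text \<open>The left side is at most \<open>y ^ j\<close> with \<open>y = n + 2\<close> and
  \<open>j = 2 * m\<close>. For \<open>j > 0\<close> the inequality
  \<open>(1 + z / j) ^ j \<le> exp z\<close> at \<open>z = y * ln 2\<close> bounds this by
  \<open>(j / ln 2) ^ j * 2 ^ (n + 2)\<close>, whence the factor 4.\<close>

lemma power_le_two_power:
  obtains C where "\<And>n. (real n ^ 2 + 4) ^ m \<le> C * 2 ^ n"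
proof -
  have "(real n ^ 2 + 4) ^ m \<le> (real (2 * m) / ln 2) ^ (2 * m) * 4 * 2 ^ n" for n
  proof -
    have "(real n ^ 2 + 4) ^ m \<le> ((real n + 2) ^ 2) ^ m"
      by (rule power_mono) (auto simp: power2_sum)
    also have "\<dots> = (real n + 2) ^ (2 * m)"
      by (simp add: power_mult)
    also have "\<dots> \<le> (real (2 * m) / ln 2) ^ (2 * m) * 4 * 2 ^ n"
    proof (cases "m = 0")
      case False
      have "(real n + 2) ^ (2 * m) =
          (real (2 * m) / ln 2) ^ (2 * m) * (((real n + 2) * ln 2) / real (2 * m)) ^ (2 * m)"
        using False by (simp flip: power_mult_distrib)
      also have "\<dots> \<le> (real (2 * m) / ln 2) ^ (2 * m) *
          (1 + ((real n + 2) * ln 2) / real (2 * m)) ^ (2 * m)"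
        by (intro mult_left_mono power_mono) auto
      also have "\<dots> \<le> (real (2 * m) / ln 2) ^ (2 * m) * exp ((real n + 2) * ln 2)"
      proof (intro mult_left_mono exp_ge_one_plus_x_over_n_power_n)
        have "0 \<le> (real n + 2) * ln 2" by simp
        then show "- real (2 * m) \<le> (real n + 2) * ln 2" by linarith
      qed (use False in auto)
      also have "exp ((real n + 2) * ln 2) = 4 * 2 ^ n"
      proof -
        have "exp ((real n + 2) * ln 2) = 2 powr (real (n + 2))"
          by (simp add: powr_def)
        then show ?thesis by (subst (asm) powr_realpow) auto
      qed
      finally show ?thesis by simp
    next
      case True
      have "(1::real) \<le> 2 ^ n" by simp
      then show ?thesis using True by (simp del: one_le_power)
    qed
    finally show ?thesis .
  qed
  then show ?thesis using that by blast
qed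

text \<open>On the support of the \<open>n\<close>-th bump, \<open>t ^ m\<close> is at most a
  constant times \<open>2 ^ n\<close>, while every derivative of the bump carries the factor
  \<open>1 / 2 ^ n\<close>.\<close>

lemma bumps_rapid_decay:
  assumes S: "S \<subseteq> {5..}"
  obtains C where "\<And>t. \<bar>t ^ m * bumps S k t\<bar> \<le> C"
proof -
  obtain M where M: "M \<ge> 0" "\<And>t. \<bar>dchi k t\<bar> \<le> M" using dchi_bounded by blast
  obtain C where C: "\<And>n. (real n ^ 2 + 4) ^ m \<le> C * 2 ^ n" using power_le_two_power by blast
  have C0: "C \<ge> 0" using C[of 0] order_trans[of 0 "4 ^ m :: real" C] by simp
  have "\<bar>t ^ m * bumps S k t\<bar> \<le> C * (2 * pi) * M" for t
  proof -
    obtain n where n: "bumps S k t = (if n \<in> S then bump n k t else 0)"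
      using bumps_local[of t] S by (metis abs_zero diff_self zero_less_one)
    show ?thesis
    proof (cases "n \<in> S \<and> \<bar>t - real n ^ 2\<bar> \<le> 4")
      case False
      then have "bumps S k t = 0" using n bump_zero[of t n k] by (auto split: if_splits)
      then show ?thesis using M C0 by simp
    next
      case True
      have "\<bar>t ^ m\<bar> \<le> (real n ^ 2 + 4) ^ m"
        unfolding power_abs using True zero_le_power2[of "real n"] by (intro power_mono) linarith+
      also have "\<dots> \<le> C * 2 ^ n" by (rule C)
      finally have 1: "\<bar>t ^ m\<bar> \<le> C * 2 ^ n" .
      have "\<bar>bump n k t\<bar> = 2 * pi / 2 ^ n * ((1/4) ^ k * \<bar>dchi k ((t - real n ^ 2) / 4)\<bar>)"
        by (simp add: bump_def abs_mult)
      also have "\<dots> \<le> 2 * pi / 2 ^ n * (1 * M)"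
        using M by (intro mult_left_mono mult_mono power_le_one) auto
      finally have 2: "\<bar>bump n k t\<bar> \<le> 2 * pi / 2 ^ n * M" by simp
      have "\<bar>t ^ m * bumps S k t\<bar> \<le> (C * 2 ^ n) * (2 * pi / 2 ^ n * M)"
        unfolding abs_mult using True n 1 2 C0 by (intro mult_mono) auto
      then show ?thesis by simp
    qed
  qed
  then show ?thesis using that by blast
qed

text \<open>These functions form a family whose linear span is closed under differentiation, as in
  the usual proof that \<open>exp (- 1/q)\<close>, extended by 0, is smooth. The power of
  \<open>1/q\<close> absorbs the factors that differentiating \<open>1/q\<close> produces.\<close>

definition recip_bumps :: "nat set \<Rightarrow> nat \<Rightarrow> nat \<Rightarrow> real \<Rightarrow> real" where
  "recip_bumps S m k q = (if q > 0 then (1/q) ^ m * bumps S k (1/q) else 0)"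

lemma recip_bumps_deriv:
  assumes S: "S \<subseteq> {5..}"
  shows "(recip_bumps S m k has_real_derivative
    - real m * recip_bumps S (m + 1) k q - recip_bumps S (m + 2) (Suc k) q) (at q)"
proof (cases q "0 :: real" rule: linorder_cases)
  case less
  have "((\<lambda>_. 0) has_real_derivative
      - real m * recip_bumps S (m + 1) k q - recip_bumps S (m + 2) (Suc k) q) (at q)"
    using less by (simp add: recip_bumps_def)
  then show ?thesis
    by (rule has_field_derivative_transform_within_open[of _ _ _ "{..<0}"])
      (use less in \<open>auto simp: recip_bumps_def\<close>)
next
  case greater
  have 1: "((\<lambda>q. bumps S k (1/q)) has_real_derivative bumps S (Suc k) (1/q) * (- ((1/q)^2))) (at q)"
    by (rule DERIV_chain2[OF bumps_deriv[OF S]])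
      (use greater in \<open>auto intro!: derivative_eq_intros simp: power2_eq_square\<close>)
  have 2: "((\<lambda>q. (1/q) ^ m) has_real_derivative (- real m * (1/q) ^ (m + 1))) (at q)"
  proof (cases m)
    case (Suc j)
    have "((\<lambda>q. 1/q) has_real_derivative - ((1/q) ^ 2)) (at q)"
      using greater by (auto intro!: derivative_eq_intros simp: power2_eq_square)
    from DERIV_power_Suc[OF this, of j]
    have "((\<lambda>q. (1/q) ^ m) has_real_derivative (1 + real j) * (- ((1/q)\<^sup>2) * (1/q) ^ j)) (at q)"
      by (simp only: Suc of_nat_eq_iff)
    also have "(1 + real j) * (- ((1/q)\<^sup>2) * (1/q) ^ j) = - real m * (1/q) ^ (m + 1)"
      by (simp add: Suc power2_eq_square) (simp add: algebra_simps add_divide_distrib diff_divide_distrib)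
    finally show ?thesis .
  qed simp
  have "((\<lambda>q. (1/q) ^ m * bumps S k (1/q)) has_real_derivative
      - real m * recip_bumps S (m + 1) k q - recip_bumps S (m + 2) (Suc k) q) (at q)"
    by (rule DERIV_cong[OF DERIV_mult[OF 2 1]])
      (use greater in \<open>simp add: recip_bumps_def power_add power2_eq_square algebra_simps\<close>)
  then show ?thesis
    by (rule has_field_derivative_transform_within_open[of _ _ _ "{0<..}"])
      (use greater in \<open>auto simp: recip_bumps_def\<close>)
next
  case equal
  \<comment> \<open>Decay of order \<open>m + 2\<close>, two more than the exponent in the function
    itself, leaves a factor \<open>h\<^sup>2\<close>. So the difference quotient at 0 tends to 0,
    the value of the claimed derivative there.\<close>
  obtain C where C: "\<And>t. \<bar>t ^ (m + 2) * bumps S k t\<bar> \<le> C"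
    using bumps_rapid_decay[OF S] by blast
  have C': "\<bar>recip_bumps S m k h\<bar> \<le> C * h\<^sup>2" for h
  proof (cases "h > 0")
    case True
    then have "recip_bumps S m k h = h\<^sup>2 * ((1/h) ^ (m + 2) * bumps S k (1/h))"
      by (simp add: recip_bumps_def power_add power2_eq_square)
    then have "\<bar>recip_bumps S m k h\<bar> = h\<^sup>2 * \<bar>(1/h) ^ (m + 2) * bumps S k (1/h)\<bar>"
      by (simp add: abs_mult)
    also have "\<dots> \<le> h\<^sup>2 * C" by (intro mult_left_mono C) auto
    finally show ?thesis by (simp add: mult.commute)
  next
    case False
    have "C \<ge> 0" using C[of 0] by simp
    then show ?thesis using False by (simp add: recip_bumps_def)
  qed
  have "(\<lambda>h. (recip_bumps S m k (0 + h) - recip_bumps S m k 0) / h) \<midarrow>0\<rightarrow> 0"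
  proof (rule Lim_null_comparison)
    show "\<forall>\<^sub>F h in at 0. norm ((recip_bumps S m k (0 + h) - recip_bumps S m k 0) / h) \<le> C * \<bar>h\<bar>"
      unfolding eventually_at
    proof (intro exI[of _ 1] conjI ballI impI)
      fix h :: real assume h: "h \<noteq> 0 \<and> dist h 0 < 1"
      have "\<bar>recip_bumps S m k h\<bar> / \<bar>h\<bar> \<le> C * h\<^sup>2 / \<bar>h\<bar>"
        by (intro divide_right_mono C') auto
      also have "\<dots> = C * \<bar>h\<bar>"
        using h by (simp add: power2_eq_square abs_if)
      finally show "norm ((recip_bumps S m k (0 + h) - recip_bumps S m k 0) / h) \<le> C * \<bar>h\<bar>"
        by (simp add: recip_bumps_def[of _ _ _ 0])
    qed auto
    show "(\<lambda>h. C * \<bar>h\<bar>) \<midarrow>0\<rightarrow> 0"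
      by (rule tendsto_eq_intros refl | simp)+
  qed
  then have "(recip_bumps S m k has_real_derivative 0) (at 0)"
    by (simp add: DERIV_def)
  then show ?thesis using equal by (simp add: recip_bumps_def[of _ _ _ 0])
qed

lemma smooth_recip_bumps:
  assumes S: "S \<subseteq> {5..}"
  shows "smooth_on UNIV (recip_bumps S m k)"
proof -
  have "Ck j UNIV (recip_bumps S m k)" for j
  proof (induction j arbitrary: m k)
    case 0
    show ?case using recip_bumps_deriv[OF S] by (auto simp: has_field_derivative_def differentiable_def)
  next
    case (Suc j)
    have "Ck j UNIV (\<lambda>x. (- real m) *\<^sub>R recip_bumps S (m + 1) k x + (- 1) *\<^sub>R recip_bumps S (m + 2) (Suc k) x)"
      by (intro Ck_add Ck_bounded_linear[OF bounded_linear_scaleR_right] Suc.IH) auto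
    moreover have "frechet_derivative (recip_bumps S m k) (at x) 1 =
        (- real m) *\<^sub>R recip_bumps S (m + 1) k x + (- 1) *\<^sub>R recip_bumps S (m + 2) (Suc k) x" for x
      using fun_cong[OF frechet_derivative_at[OF recip_bumps_deriv[OF S, unfolded has_field_derivative_def]], of m k x 1]
      by simp
    moreover have "recip_bumps S m k differentiable (at x)" for x
      using recip_bumps_deriv[OF S] unfolding has_field_derivative_def differentiable_def by blast
    ultimately show ?case by simp
  qed
  then show ?thesis by (simp add: smooth_on_iff_Ck)
qed

text \<open>The argument is the square of the radius, so that the angle becomes a smooth function of
  the point even at the center.\<close>

definition angle :: "nat set \<Rightarrow> real \<Rightarrow> real" where
  "angle S = recip_bumps S 0 0"

section \<open>Values of the angle on and between the rings\<close>

lemma smooth_angle: "S \<subseteq> {5..} \<Longrightarrow> smooth_on UNIV (angle S)"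
  unfolding angle_def by (rule smooth_recip_bumps)

lemma angle_pos: "q > 0 \<Longrightarrow> angle S q = bumps S 0 (1/q)"
  by (simp add: angle_def recip_bumps_def)

lemma angle_nonpos: "q \<le> 0 \<Longrightarrow> angle S q = 0"
  by (simp add: angle_def recip_bumps_def)

lemma angle_eq_zero:
  assumes "S \<subseteq> {n0..}" "5 \<le> n0" "1/q < real n0 ^ 2 - 4"
  shows "angle S q = 0"
proof (cases "q > 0")
  case True
  have "\<bar>1/q - real m ^ 2\<bar> > 4" if "m \<in> S" for m
  proof -
    have "real m ^ 2 \<ge> real n0 ^ 2"
      by (rule power_mono) (use that assms in auto)
    then show ?thesis using assms(3) by linarith
  qed
  then have "bumps S 0 (1/q) = 0"
    by (intro bumps_eq_zero) (use assms in auto)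
  then show ?thesis using True by (simp add: angle_pos)
qed (simp add: angle_nonpos)

text \<open>Distance less than 2 from \<open>n ^ 2\<close> puts the argument of \<open>chi\<close>
  between -1/2 and 1/2, where \<open>chi\<close> is 1. All other squares are then farther away than
  11 - 2 = 9, so their bumps vanish.\<close>

lemma angle_near_square:
  assumes S: "S \<subseteq> {5..}" and n: "5 \<le> n" "\<bar>1/q - real n ^ 2\<bar> < 2"
  shows "angle S q = (if n \<in> S then 2 * pi / 2 ^ n else 0)"
proof -
  have "real n ^ 2 \<ge> 5 ^ 2" by (rule power_mono) (use n in auto)
  then have "real n ^ 2 \<ge> 25" by simp
  then have "1/q > 0" using n by linarith
  then have "q > 0" by simp
  moreover have "bumps S 0 (1/q) = (if n \<in> S then bump n 0 (1/q) else 0)"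
  proof (rule bumps_eq[OF S])
    fix m :: nat assume "5 \<le> m" "m \<noteq> n"
    then show "4 < \<bar>1/q - (real m)\<^sup>2\<bar>"
      using square_gap[of n m] square_gap[of m n] n by (cases "m < n") auto
  qed
  moreover have "bump n 0 (1/q) = 2 * pi / 2 ^ n"
    unfolding bump_def dchi_0 by (subst chi_one) (use n in auto)
  ultimately show ?thesis by (simp add: angle_pos)
qed

lemma open_recip_ball: "open {y :: real. 0 < y \<and> \<bar>1/y - t\<bar> < e}"
proof -
  have "continuous_on {0<..} (\<lambda>y::real. \<bar>1/y - t\<bar>)"
    by (auto intro!: continuous_intros)
  then have "open ({0<..} \<inter> (\<lambda>y::real. \<bar>1/y - t\<bar>) -` {..<e})"
    by (intro continuous_open_preimage) auto
  moreover have "{0<..} \<inter> (\<lambda>y::real. \<bar>1/y - t\<bar>) -` {..<e} = {y. 0 < y \<and> \<bar>1/y - t\<bar> < e}"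
    by auto
  ultimately show ?thesis by simp
qed

text \<open>Near \<open>q\<close> at most one bump is active, and its index either belongs to
  \<open>S\<close> or does not. So locally only two functions occur, however \<open>S\<close> is
  chosen inside \<open>T\<close>; this yields estimates uniform in \<open>S\<close>.\<close>

lemma angle_local_cases:
  assumes "q > 0" "S \<subseteq> T" "T \<subseteq> {5..}"
  obtains J where "open J" "q \<in> J" "(\<forall>y\<in>J. angle S y = angle T y) \<or> (\<forall>y\<in>J. angle S y = 0)"
proof -
  have S: "S \<subseteq> {5..}" using assms by auto
  obtain n where n: "\<And>s T k. \<bar>s - 1/q\<bar> < 1 \<Longrightarrow> T \<subseteq> {5..} \<Longrightarrow> bumps T k s = (if n \<in> T then bump n k s else 0)"
    using bumps_local by blast
  show ?thesis
  proof (rule that[of "{y. 0 < y \<and> \<bar>1/y - 1/q\<bar> < 1}"])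
    show "(\<forall>y\<in>{y. 0 < y \<and> \<bar>1/y - 1/q\<bar> < 1}. angle S y = angle T y) \<or>
        (\<forall>y\<in>{y. 0 < y \<and> \<bar>1/y - 1/q\<bar> < 1}. angle S y = 0)"
      using n S assms by (cases "n \<in> S") (auto simp: angle_pos)
  qed (use assms open_recip_ball in auto)
qed

lemma angle_gaps:
  assumes "e > 0" "S \<subseteq> {5..}"
  obtains q J where "0 < q" "q < e" "open J" "q \<in> J" "\<And>y. y \<in> J \<Longrightarrow> angle S y = 0"
proof -
  obtain n0 where n0: "real n0 > 1/e" using reals_Archimedean2 by blast
  define n where "n = max 5 n0"
  \<comment> \<open>The point \<open>n ^ 2 + 5\<close> has distance 5 from \<open>n ^ 2\<close> and
    at least 6 from the next square, while bumps vanish beyond distance 4. The margin of 1 leaves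
    room for a neighborhood of radius 1/2.\<close>
  define t where "t = real n ^ 2 + 5"
  have n: "real n > 1/e" "5 \<le> n" using n0 by (auto simp: n_def)
  have "real n ^ 2 \<ge> real n * 1"
    unfolding power2_eq_square by (rule mult_left_mono) (use n in auto)
  then have t: "t > 1/e" "t > 0" using n unfolding t_def by linarith+
  have far: "\<bar>t - real m ^ 2\<bar> \<ge> 5" if "5 \<le> m" for m
    using square_gap[of n m] square_gap[of m n] that n
    by (cases "m < n"; cases "m = n") (auto simp: t_def)
  show ?thesis
  proof (rule that[of "1/t" "{y. 0 < y \<and> \<bar>1/y - t\<bar> < 1/2}"])
    show "open {y. 0 < y \<and> \<bar>1/y - t\<bar> < 1/2}" by (rule open_recip_ball)
    show "1/t < e" using t assms by (simp add: field_simps)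
    fix y assume y: "y \<in> {y. 0 < y \<and> \<bar>1/y - t\<bar> < 1/2}"
    have "bumps S 0 (1/y) = 0"
    proof (rule bumps_eq_zero[OF assms(2)])
      fix m assume "m \<in> S"
      then have "\<bar>t - real m ^ 2\<bar> \<ge> 5" using far assms by auto
      then show "4 < \<bar>1/y - (real m)\<^sup>2\<bar>" using y by (simp add: abs_if split: if_splits)
    qed
    then show "angle S y = 0" using y by (simp add: angle_pos)
  qed (use t in auto)
qed

end

section \<open>Rotations by an angle depending on the radius\<close>

text \<open>Multiplication by the imaginary unit under \<open>plane_of_complex\<close>.\<close>

definition quarter_turn :: "real^2 \<Rightarrow> real^2" where
  "quarter_turn x = vector [- x$2, x$1]"

definition rot :: "(real \<Rightarrow> real) \<Rightarrow> real^2 \<Rightarrow> real^2" where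
  "rot w x = cos (w (x \<bullet> x)) *\<^sub>R x + sin (w (x \<bullet> x)) *\<^sub>R quarter_turn x"

lemma bounded_linear_quarter_turn: "bounded_linear quarter_turn"
  by (auto intro!: linearI simp: linear_conv_bounded_linear[symmetric] quarter_turn_def
      vec_eq_iff forall_2)

lemma smooth_rot:
  assumes "smooth_on UNIV w"
  shows "smooth_on UNIV (rot w)"
proof -
  have nth: "smooth_on UNIV (\<lambda>x::real^2. x $ i)" for i
    by (rule smooth_on_bounded_linear[OF bounded_linear_vec_nth]) simp
  have "smooth_on UNIV (\<lambda>x::real^2. x$1 *\<^sub>R x$1 + x$2 *\<^sub>R x$2)"
    by (intro smooth_on_add smooth_on_scaleR nth) auto
  then have "smooth_on UNIV (\<lambda>x::real^2. x \<bullet> x)"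
    by (simp add: inner_vec_def sum_2)
  then have u: "smooth_on UNIV (\<lambda>x::real^2. w (x \<bullet> x))"
    by (intro smooth_on_compose[OF _ _ _ assms]) auto
  have id: "smooth_on UNIV (\<lambda>x::real^2. x)"
    by (rule smooth_on_bounded_linear) auto
  show ?thesis
    unfolding rot_def[abs_def]
    by (intro smooth_on_add smooth_on_scaleR smooth_on_compose[OF _ _ _ smooth_on_cos u]
        smooth_on_compose[OF _ _ _ smooth_on_sin u]
        smooth_on_bounded_linear bounded_linear_quarter_turn id) auto
qed

lemma plane_of_complex_nth [simp]:
  "plane_of_complex z $ 1 = Re z" "plane_of_complex z $ 2 = Im z"
  by (simp_all add: plane_of_complex_def)

lemma plane_of_complex_cases: obtains z where "x = plane_of_complex z"
  using that[of "Complex (x$1) (x$2)"] by (simp add: vec_eq_iff forall_2)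

lemma plane_of_complex_diff: "plane_of_complex (a - b) = plane_of_complex a - plane_of_complex b"
  by (simp add: vec_eq_iff forall_2)

lemma norm_plane_of_complex [simp]: "norm (plane_of_complex z) = cmod z"
  by (simp add: norm_vec_def L2_set_def sum_2 cmod_def)

lemma rot_plane_of_complex:
  "rot w (plane_of_complex z) = plane_of_complex (cis (w ((cmod z)\<^sup>2)) * z)"
  by (simp add: rot_def quarter_turn_def vec_eq_iff forall_2 algebra_simps flip: power2_norm_eq_inner)

lemma norm_rot [simp]: "norm (rot w x) = norm x"
  by (cases x rule: plane_of_complex_cases) (simp add: rot_plane_of_complex norm_mult)

text \<open>The rotation preserves the norm, so the second map uses the angle at the same radius and
  cancels the first.\<close>

lemma rot_rot_uminus: "rot (\<lambda>q. - w q) (rot w x) = x"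
  by (cases x rule: plane_of_complex_cases)
    (simp add: rot_plane_of_complex norm_mult cis_mult flip: mult.assoc)

lemma rot_eq_id: "w (x \<bullet> x) = 0 \<Longrightarrow> rot w x = x"
  by (simp add: rot_def)

text \<open>Let J be the quarter turn and R the rotation by the angle at \<open>x\<close>. The
  derivative is R plus the rank-one map taking \<open>h\<close> to
  \<open>(k * (x \<bullet> h))\<close> times J R x. Its determinant is 1 plus \<open>k\<close> times
  the inner product of \<open>x\<close> and J x, which is 0.\<close>

lemma jac_det_rot:
  assumes "smooth_on UNIV w"
  shows "jac_det (rot w) x = 1"
proof -
  define c s where "c = cos (w (x \<bullet> x))" and "s = sin (w (x \<bullet> x))"
  have "w differentiable (at (x \<bullet> x))"
    using assms by (rule smooth_on_differentiable) simp
  then obtain w' where w': "(w has_real_derivative w') (at (x \<bullet> x))"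
    by (auto simp: real_differentiable_def)
  define k where "k = 2 * w'"
  let ?D = "\<lambda>h. c *\<^sub>R h + s *\<^sub>R quarter_turn h + (k * (x \<bullet> h)) *\<^sub>R (c *\<^sub>R quarter_turn x - s *\<^sub>R x)"
  have u: "((\<lambda>x. w (x \<bullet> x)) has_derivative (\<lambda>h. w' * (2 * (x \<bullet> h)))) (at x)"
    by (rule has_derivative_compose[of "\<lambda>x. x \<bullet> x" _ x UNIV w, OF _ w'[unfolded has_field_derivative_def]])
      (auto intro!: derivative_eq_intros simp: inner_commute)
  have q: "(quarter_turn has_derivative quarter_turn) (at x)"
    by (rule bounded_linear_imp_has_derivative[OF bounded_linear_quarter_turn])
  have "(rot w has_derivative ?D) (at x)"
    unfolding rot_def[abs_def]
    by (rule derivative_eq_intros u q refl)+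
      (auto simp: c_def s_def k_def scaleR_diff_right algebra_simps)
  then have "frechet_derivative (rot w) (at x) = ?D"
    by (rule frechet_derivative_at[symmetric])
  then have "jac_det (rot w) x = det (matrix ?D)"
    by (simp add: jac_det_def jacobian_def)
  also have "\<dots> = (c + k * x$1 * (c * - x$2 - s * x$1)) * (c + k * x$2 * (c * x$1 - s * x$2))
      - (- s + k * x$2 * (c * - x$2 - s * x$1)) * (s + k * x$1 * (c * x$1 - s * x$2))"
    by (simp add: det_2 matrix_def quarter_turn_def inner_vec_def sum_2 axis_def algebra_simps)
  also have "\<dots> = s\<^sup>2 + c\<^sup>2"
    by (simp add: power2_eq_square algebra_simps)
  also have "\<dots> = 1"
    by (simp add: c_def s_def)
  finally show ?thesis .
qed

section \<open>The rings of disks\<close>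

lemma pt_eq: "pt n s = plane_of_complex (cis (2 * pi * real s / 2 ^ n) / of_nat n)"
proof -
  have "exp (2 * of_real pi * of_nat s / 2 ^ n * \<i>) = cis (2 * pi * real s / 2 ^ n)"
    by (simp add: cis_conv_exp mult_ac)
  then show ?thesis by (simp add: pt_def)
qed

lemma norm_pt [simp]: "norm (pt n s) = 1 / real n"
  by (simp add: pt_eq norm_divide)

lemma pt_top: "pt n (2 ^ n + s) = pt n s"
proof -
  have "2 * pi * real (2 ^ n + s) / 2 ^ n = 2 * pi * real s / 2 ^ n + 2 * pi"
    by (simp add: field_simps)
  then show ?thesis by (simp add: pt_eq flip: cis_mult)
qed

lemma rad_pos: "n > 0 \<Longrightarrow> rad n > 0"
  by (simp add: rad_def)

text \<open>At the point \<open>x\<close>, \<open>rot w\<close> acts as the linear rotation by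
  \<open>2 * pi / 2 ^ n\<close>, an isometry that takes \<open>pt n s\<close> to
  \<open>pt n (Suc s)\<close>.\<close>

lemma norm_rot_diff_pt:
  assumes "w (x \<bullet> x) = 2 * pi / 2 ^ n"
  shows "norm (rot w x - pt n (Suc s)) = norm (x - pt n s)"
proof -
  obtain z where x: "x = plane_of_complex z" by (rule plane_of_complex_cases)
  have "(cmod z)\<^sup>2 = x \<bullet> x" using x by (simp flip: power2_norm_eq_inner)
  then have "rot w x = plane_of_complex (cis (2 * pi / 2 ^ n) * z)"
    using assms by (simp add: x rot_plane_of_complex)
  moreover have "pt n (Suc s) = plane_of_complex (cis (2 * pi / 2 ^ n) * (cis (2 * pi * real s / 2 ^ n) / of_nat n))"
    unfolding pt_eq by (simp add: cis_mult add_divide_distrib distrib_left)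
  ultimately have "rot w x - pt n (Suc s) =
      plane_of_complex (cis (2 * pi / 2 ^ n) * (z - cis (2 * pi * real s / 2 ^ n) / of_nat n))"
    by (simp only: plane_of_complex_diff right_diff_distrib)
  then show ?thesis
    by (simp add: x pt_eq norm_mult flip: plane_of_complex_diff)
qed

lemma annulus:
  assumes "norm (x - pt n s) < rad n"
  shows "\<bar>norm x - 1 / real n\<bar> < rad n"
  using norm_triangle_ineq3[of x "pt n s"] assms by simp

text \<open>Outside the annulus of the ring both sides vanish, because the norm is preserved. Inside
  it the rotation is trivial or permutes the disks cyclically.\<close>

lemma ring_coeff_rot:
  assumes n: "n > 0" and chi_zero: "\<And>t. \<bar>t\<bar> \<ge> 1 \<Longrightarrow> chi t = 0"
    and w: "\<bar>norm x - 1 / real n\<bar> < rad n \<Longrightarrow> w (x \<bullet> x) \<in> {0, 2 * pi / 2 ^ n}"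
  shows "ring_coeff chi n (rot w x) = ring_coeff chi n x"
proof (cases "\<bar>norm x - 1 / real n\<bar> < rad n")
  case False
  have "disc_coeff chi (pt n s) (rad n) y = 0" if "norm y = norm x" for y s
  proof -
    have "norm (y - pt n s) \<ge> rad n"
      using annulus[of y n s] False that by force
    then show ?thesis
      unfolding disc_coeff_def using rad_pos[OF n] by (intro chi_zero) (auto simp: divide_simps)
  qed
  then show ?thesis by (simp add: ring_coeff_def)
next
  case True
  show ?thesis
  proof (cases "w (x \<bullet> x) = 0")
    case True
    then show ?thesis by (simp add: rot_eq_id)
  next
    case False
    let ?g = "\<lambda>s. disc_coeff chi (pt n s) (rad n) (rot w x)"
    have *: "w (x \<bullet> x) = 2 * pi / 2 ^ n" using w True False by blast
    \<comment> \<open>The rotated summands are the original ones with the index shifted by one; the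
      last index, \<open>Suc (2 ^ n)\<close>, wraps around to 1.\<close>
    have "(\<Sum>s = 1..2 ^ n. disc_coeff chi (pt n s) (rad n) x) = (\<Sum>s = 1..2 ^ n. ?g (Suc s))"
      by (simp add: disc_coeff_def norm_rot_diff_pt[of w x n, OF *])
    also have "\<dots> = (\<Sum>s = Suc 1..Suc (2 ^ n). ?g s)"
      by (simp only: sum.shift_bounds_cl_Suc_ivl)
    also have "\<dots> = (\<Sum>s = Suc 1..2 ^ n. ?g s) + ?g (Suc (2 ^ n))"
      by (rule sum.cl_ivl_Suc[THEN trans]) simp
    also have "?g (Suc (2 ^ n)) = ?g 1"
      using pt_top[of n 1] by simp
    also have "(\<Sum>s = Suc 1..2 ^ n. ?g s) + ?g 1 = (\<Sum>s = 1..2 ^ n. ?g s)"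
      by (subst (2) sum.atLeast_Suc_atMost) (simp_all add: add.commute)
    finally show ?thesis by (simp add: ring_coeff_def)
  qed
qed

text \<open>The outer radius decreases with the index, so \<open>m = n + 1\<close> is the critical
  case. There the gap \<open>1 / (n * (n + 1))\<close> must exceed or equal the sum of the two
  radii, which amounts to \<open>3 * n + 2 \<le> 2 * 2 ^ n\<close>.\<close>

lemma annuli_disjoint:
  assumes "4 \<le> n" "n < m"
  shows "1 / real m + rad m \<le> 1 / real n - rad n"
proof -
  have two: "3 * real n + 2 \<le> 2 * 2 ^ n"
    using assms(1) by (induction n rule: nat_induct_at_least) auto
  have "1 / real m + rad m \<le> 1 / real (n + 1) + rad (n + 1)"
    unfolding rad_def using assms
    by (intro add_mono divide_left_mono mult_mono power_increasing) auto
  also have "\<dots> \<le> 1 / real n - rad n"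
  proof -
    have "real n * (2 * 2 ^ n + 1) \<le> (real n + 1) * (2 * 2 ^ n - 2)"
      using two by (simp add: algebra_simps)
    then have "(2 * 2 ^ n + 1) / ((real n + 1) * (2 * 2 ^ n)) \<le> (2 * 2 ^ n - 2) / (real n * (2 * 2 ^ n))"
      using assms by (simp add: divide_simps) (simp add: algebra_simps)
    then show ?thesis using assms
      by (simp add: rad_def divide_simps) (simp add: algebra_simps)
  qed
  finally show ?thesis .
qed

text \<open>For \<open>j = 1\<close> use the mean value theorem with cosine at least 1/2 up to
  \<open>pi / 3\<close>. Monotonicity handles larger \<open>j\<close> up to \<open>pi / 2\<close>,
  and reflection at \<open>pi / 2\<close> the rest.\<close>

lemma sin_pi_divide_ge:
  fixes N j :: nat
  assumes "16 \<le> N" "1 \<le> j" "j < N"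
  shows "1 / real N \<le> sin (pi * real j / real N)"
proof -
  have base: "1 / real N \<le> sin (pi / real N)"
  proof -
    have x: "0 < pi / real N" "pi / real N \<le> pi / 3"
      by (use assms in simp) (rule divide_left_mono, use assms in auto)
    obtain z where z: "0 < z" "z < pi / real N" "sin (pi / real N) - sin 0 = (pi / real N - 0) * cos z"
      using MVT2[of 0 "pi / real N" sin cos] x DERIV_sin by auto
    have "cos (pi / 3) \<le> cos z"
      using less_le_trans[OF z(2) x(2)] z by (intro cos_monotone_0_pi_le) auto
    then have "pi / real N * (1/2) \<le> pi / real N * cos z"
      using x by (intro mult_left_mono) (auto simp: cos_60)
    moreover have "1 / real N \<le> pi / real N * (1/2)"
      using pi_ge_two assms by (simp add: field_simps)
    ultimately show ?thesis using z by simp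
  qed
  have mono: "sin (pi / real N) \<le> sin (pi * real i / real N)" if "1 \<le> i" "2 * i \<le> N" for i :: nat
  proof (rule sin_monotone_2pi_le)
    have "pi * 1 \<le> pi * real i" using that by (intro mult_left_mono) auto
    then show "pi / real N \<le> pi * real i / real N" by (simp add: divide_right_mono)
    have "real i / real N \<le> 1/2" using that by (simp add: divide_simps)
    then show "pi * real i / real N \<le> pi / 2"
      using mult_left_mono[of "real i / real N" "1/2" pi] by simp
    have "0 \<le> pi / real N" by simp
    then show "- (pi / 2) \<le> pi / real N" using pi_gt_zero by linarith
  qed
  show ?thesis
  proof (cases "2 * j \<le> N")
    case True
    then show ?thesis using base mono[of j] assms by simp
  next
    case False
    have "pi * real (N - j) / real N = pi - pi * real j / real N"
      using assms by (simp add: of_nat_diff field_simps)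
    moreover have "1 \<le> N - j" "2 * (N - j) \<le> N" using assms False by auto
    ultimately have "sin (pi / real N) \<le> sin (pi - pi * real j / real N)"
      using mono[of "N - j"] by metis
    then show ?thesis using base by simp
  qed
qed

text \<open>The chord of the angle \<open>a\<close> on the circle of radius \<open>1 / n\<close> has
  length \<open>2 * \<bar>sin (a / 2)\<bar> / n\<close>. The sine bound with
  \<open>2 ^ n \<ge> 16\<close> points makes this at least two disk radii.\<close>

lemma norm_pt_diff:
  assumes n: "4 \<le> n" and s: "1 \<le> s" and st: "s < t" "t \<le> 2 ^ n"
  shows "2 * rad n \<le> norm (pt n t - pt n s)"
proof -
  define a where "a = 2 * pi * real (t - s) / 2 ^ n"
  have "2 * pi * real t / 2 ^ n = 2 * pi * real s / 2 ^ n + a"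
    using st by (simp add: a_def of_nat_diff field_simps)
  then have "pt n t - pt n s = plane_of_complex (cis (2 * pi * real s / 2 ^ n) * (cis a - 1) / of_nat n)"
    by (simp add: pt_eq right_diff_distrib diff_divide_distrib cis_mult flip: plane_of_complex_diff)
  then have "norm (pt n t - pt n s) = cmod (cis a - 1) / real n"
    by (simp add: norm_divide norm_mult)
  also have "cmod (cis a - 1) = 2 * \<bar>sin (a / 2)\<bar>"
    unfolding cis_conv_exp by (rule dist_exp_i_1)
  also have "a / 2 = pi * real (t - s) / real (2 ^ n)"
    by (simp add: a_def)
  finally have *: "norm (pt n t - pt n s) = 2 * \<bar>sin (pi * real (t - s) / real (2 ^ n))\<bar> / real n" .
  have "(2::nat) ^ 4 \<le> 2 ^ n" by (rule power_increasing) (use n in auto)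
  then have "1 / real (2 ^ n) \<le> sin (pi * real (t - s) / real (2 ^ n))"
    by (intro sin_pi_divide_ge) (use s st in auto)
  then have "2 * (1 / real (2 ^ n)) / real n \<le> 2 * \<bar>sin (pi * real (t - s) / real (2 ^ n))\<bar> / real n"
    by (intro divide_right_mono mult_left_mono) auto
  then show ?thesis
    by (simp only: *) (simp add: rad_def mult.commute)
qed

section \<open>The disks of all rings and the support of the coefficient\<close>

definition ring_index :: "(nat \<times> nat) set" where
  "ring_index = (SIGMA n:{4..}. {1..2 ^ n})"

definition ring_ball :: "nat \<times> nat \<Rightarrow> (real^2) set" where
  "ring_ball i = ball (pt (fst i) (snd i)) (rad (fst i))"

lemma ring_ball_iff: "x \<in> ring_ball (n, s) \<longleftrightarrow> norm (x - pt n s) < rad n"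
  by (simp add: ring_ball_def dist_norm norm_minus_commute)

text \<open>Disks of different rings lie in disjoint annuli; within one ring the centers are at
  least two radii apart.\<close>

lemma ring_ball_disjoint:
  assumes "i \<in> ring_index" "j \<in> ring_index" "x \<in> ring_ball i" "x \<in> ring_ball j"
  shows "i = j"
proof -
  obtain n s m t where ij: "i = (n, s)" "j = (m, t)" by fastforce
  have b: "4 \<le> n" "4 \<le> m" "1 \<le> s" "1 \<le> t" "s \<le> 2 ^ n" "t \<le> 2 ^ m"
    "norm (x - pt n s) < rad n" "norm (x - pt m t) < rad m"
    using assms by (auto simp: ij ring_index_def ring_ball_iff)
  have "n = m"
    using annulus[OF b(7)] annulus[OF b(8)] annuli_disjoint[of n m] annuli_disjoint[of m n] b
    by (cases n m rule: linorder_cases) (auto simp: abs_less_iff)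
  moreover have "norm (pt n t - pt n s) < 2 * rad n" if "n = m"
    using norm_triangle_lt[of "pt n t - x" "x - pt n s" "2 * rad n"] b that
    by (simp add: norm_minus_commute)
  ultimately have "s = t"
    using norm_pt_diff[of n s t] norm_pt_diff[of n t s] b
    by (cases s t rule: linorder_cases) (auto simp: norm_minus_commute)
  then show ?thesis using ij \<open>n = m\<close> by simp
qed

context cutoff begin

lemma ring_coeff_nonzero:
  assumes "n > 0" "ring_coeff chi n x \<noteq> 0"
  shows "\<exists>s\<in>{1..2 ^ n}. x \<in> ring_ball (n, s)"
proof -
  have "\<exists>s\<in>{1..2 ^ n}. disc_coeff chi (pt n s) (rad n) x \<noteq> 0"
    using assms(2) unfolding ring_coeff_def by (metis mult_zero_right sum.neutral)
  then obtain s where s: "s \<in> {1..2 ^ n}" "chi (norm (x - pt n s) / rad n) \<noteq> 0"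
    by (auto simp: disc_coeff_def)
  then have "norm (x - pt n s) / rad n < 1"
    using chi_zero[of "norm (x - pt n s) / rad n"] by linarith
  then have "norm (x - pt n s) < rad n"
    using rad_pos[OF assms(1)] by simp
  then show ?thesis using s by (auto simp: ring_ball_iff)
qed

lemma disk_coeff_nonzero:
  assumes "disk_coeff chi x \<noteq> 0"
  shows "\<exists>i\<in>ring_index. x \<in> ring_ball i"
proof (rule ccontr)
  assume *: "\<not> ?thesis"
  have "ring_coeff chi (n + 4) x = 0" for n
  proof (rule ccontr)
    assume "ring_coeff chi (n + 4) x \<noteq> 0"
    then obtain s where "s \<in> {1..2 ^ (n + 4)}" "x \<in> ring_ball (n + 4, s)"
      using ring_coeff_nonzero[of "n + 4" x] by auto
    then show False using * by (auto simp: ring_index_def)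
  qed
  then show False using assms by (simp add: disk_coeff_def)
qed

lemma disk_coeff_pt:
  assumes "4 \<le> n" "s \<in> {1..2 ^ n}"
  shows "disk_coeff chi (pt n s) \<noteq> 0"
proof -
  have mem: "pt n s \<in> ring_ball (n, s)" "(n, s) \<in> ring_index"
    using assms by (auto simp: ring_ball_iff rad_pos ring_index_def)
  \<comment> \<open>The series starts with ring 4, so ring \<open>n\<close> is its term of index
    \<open>n - 4\<close>. All other terms vanish at the center of the disk, by disjointness.\<close>
  have z: "ring_coeff chi (k + 4) (pt n s) = 0" if "k \<notin> {n - 4}" for k
  proof (rule ccontr)
    assume "ring_coeff chi (k + 4) (pt n s) \<noteq> 0"
    then obtain t where t: "t \<in> {1..2 ^ (k + 4)}" "pt n s \<in> ring_ball (k + 4, t)"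
      using ring_coeff_nonzero[of "k + 4" "pt n s"] by auto
    then have "(k + 4, t) \<in> ring_index" by (auto simp: ring_index_def)
    then show False using ring_ball_disjoint[OF _ mem(2) t(2) mem(1)] that by auto
  qed
  have "disk_coeff chi (pt n s) = ring_coeff chi n (pt n s)"
    unfolding disk_coeff_def by (subst suminf_finite[of "{n - 4}"]) (use z assms in auto)
  moreover have "(\<Sum>t = 1..2 ^ n. disc_coeff chi (pt n t) (rad n) (pt n s)) > 0"
  proof (rule sum_pos2[of _ s])
    show "0 < disc_coeff chi (pt n s) (rad n) (pt n s)"
      by (simp add: disc_coeff_def chi_one)
  qed (use assms chi_range in \<open>auto simp: disc_coeff_def\<close>)
  ultimately show ?thesis by (simp add: ring_coeff_def)
qed

text \<open>Write the norm of \<open>x\<close> as \<open>(1 + a) / n\<close> with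
  \<open>\<bar>a\<bar> < 1 / 2 ^ n\<close>. Then \<open>1 / (x \<bullet> x)\<close> is
  \<open>n ^ 2 / (1 + a) ^ 2\<close>, and for \<open>n \<ge> 5\<close> it differs from
  \<open>n ^ 2\<close> by less than 2, so the whole ring lies on the plateau of its bump.\<close>

lemma angle_on_ring:
  assumes S: "S \<subseteq> {5..}" and n: "4 \<le> n" and x: "\<bar>norm x - 1 / real n\<bar> < rad n"
  shows "angle S (x \<bullet> x) = (if n \<in> S then 2 * pi / 2 ^ n else 0)"
proof -
  define a where "a = real n * norm x - 1"
  have nx: "norm x = (1 + a) / real n" using n by (simp add: a_def)
  have "\<bar>a\<bar> = real n * \<bar>norm x - 1 / real n\<bar>"
    using n by (simp add: a_def abs_mult_pos' right_diff_distrib)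
  also have "\<dots> < real n * rad n" using x n by (intro mult_strict_left_mono) auto
  finally have a: "\<bar>a\<bar> < 1 / 2 ^ n" using n by (simp add: rad_def)
  have q: "1 / (x \<bullet> x) = real n ^ 2 / (1 + a) ^ 2"
    using nx by (simp add: power_divide flip: power2_norm_eq_inner)
  show ?thesis
  proof (cases "n = 4")
    case True
    \<comment> \<open>Ring 4 carries no bump. On it \<open>1 / (x \<bullet> x)\<close> is at most
      \<open>16 / (15/16) ^ 2\<close>, below 21 = 25 - 4, where the first possible bump
      begins.\<close>
    then have "(1 + a) ^ 2 \<ge> (15/16) ^ 2"
      using a by (intro power_mono) auto
    then have "1 / (x \<bullet> x) \<le> 16 / (15/16) ^ 2"
      unfolding q using True by (auto intro!: divide_left_mono mult_pos_pos)
    then have "1 / (x \<bullet> x) < real 5 ^ 2 - 4" by (simp add: power2_eq_square)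
    then have "angle S (x \<bullet> x) = 0" by (intro angle_eq_zero[OF S]) auto
    then show ?thesis using S True by auto
  next
    case False
    then have n5: "5 \<le> n" using n by simp
    \<comment> \<open>Equality holds at \<open>n = 5\<close>; afterwards \<open>n ^ 2\<close> at
      most doubles from one step to the next.\<close>
    have n2: "real n ^ 2 \<le> 25/32 * 2 ^ n"
      using n5
    proof (induction n rule: nat_induct_at_least)
      case (Suc n)
      have "5 * real n \<le> real n ^ 2" "5 \<le> real n"
        unfolding power2_eq_square using Suc by (auto intro!: mult_right_mono)
      moreover have "real (Suc n) ^ 2 = real n ^ 2 + 2 * real n + 1"
        by (simp add: power2_sum)
      ultimately have "real (Suc n) ^ 2 \<le> 2 * real n ^ 2" by linarith
      then show ?case using Suc by simp
    qed simp
    have p: "1 / 2 ^ n \<le> (1 / 32 :: real)"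
      using power_increasing[of 5 n "2::real"] n5 by (simp add: divide_simps)
    then have a': "\<bar>a\<bar> \<le> 1/32" using a by linarith
    have "real n ^ 2 * \<bar>a\<bar> \<le> 25/32 * 2 ^ n * (1 / 2 ^ n)"
      using n2 a by (intro mult_mono) auto
    then have na: "real n ^ 2 * \<bar>a\<bar> \<le> 25/32" by simp
    have "real n ^ 2 / (1 + a) ^ 2 - real n ^ 2 = - (real n ^ 2 * a * (2 + a) / (1 + a) ^ 2)"
      using a' by (simp add: divide_simps abs_if split: if_splits) (auto simp: power2_eq_square algebra_simps)
    then have "\<bar>1 / (x \<bullet> x) - real n ^ 2\<bar> = (real n ^ 2 * \<bar>a\<bar>) * \<bar>2 + a\<bar> / (1 + a) ^ 2"
      unfolding q by (simp add: abs_mult)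
    also have "\<dots> \<le> 25/32 * (65/32) / (31/32) ^ 2"
      using na a' by (intro frac_le mult_mono power_mono) auto
    also have "\<dots> < 2" by (simp add: power2_eq_square)
    finally show ?thesis by (intro angle_near_square[OF S n5])
  qed
qed

lemma disk_coeff_rot:
  assumes S: "S \<subseteq> {5..}"
  shows "disk_coeff chi (rot (angle S) x) = disk_coeff chi x"
proof -
  have "ring_coeff chi (n + 4) (rot (angle S) x) = ring_coeff chi (n + 4) x" for n
    by (rule ring_coeff_rot) (use angle_on_ring[OF S, of "n + 4" x] chi_zero in auto)
  then show ?thesis by (simp add: disk_coeff_def)
qed

lemma rot_pt:
  assumes S: "S \<subseteq> {5..}" and n: "4 \<le> n"
  shows "rot (angle S) (pt n s) = (if n \<in> S then pt n (Suc s) else pt n s)"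
proof -
  have "angle S (pt n s \<bullet> pt n s) = (if n \<in> S then 2 * pi / 2 ^ n else 0)"
    by (rule angle_on_ring[OF S n]) (use rad_pos[of n] n in auto)
  then show ?thesis
    using norm_rot_diff_pt[of "angle S" "pt n s" n s] by (auto simp: rot_eq_id)
qed

end

section \<open>Rotations supported in a coordinate disk of a surface\<close>

lemma open_chart_image:
  assumes "is_chart c" "open W"
  shows "open (snd c ` (fst c \<inter> W))"
  \<comment> \<open>\<open>rep_dom\<close> uses only the domain of its second chart, so the pair
    \<open>(W, snd c)\<close> can stand in for a chart with domain \<open>W\<close>.\<close>
  using open_rep_dom[of c "(W, snd c)" id] assms by (simp add: rep_dom_def)

lemma chart_continuous_on:
  assumes "is_chart c"
  shows "continuous_on (fst c) (snd c)" "continuous_on (snd c ` fst c) (inv_into (fst c) (snd c))"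
  using assms by (auto simp: is_chart_def homeomorphism_def)

lemma open_chart_vimage:
  assumes "is_chart c" "open W"
  shows "open (fst c \<inter> snd c -` W)"
  using assms by (auto simp: is_chart_def intro!: continuous_open_preimage chart_continuous_on)

lemma iter_deriv_rep_cong:
  assumes c: "is_chart c" and "open W" "p \<in> fst c" "p \<in> W" and eq: "\<And>q. q \<in> W \<Longrightarrow> f q = g q"
  shows "iter_deriv vs (rep c d f) (snd c p) = iter_deriv vs (rep c d g) (snd c p)"
  by (rule iter_deriv_cong[OF open_chart_image[OF c \<open>open W\<close>]])
    (use assms in \<open>auto simp: rep_def is_chart_inv[OF c]\<close>)

lemma jac_det_rep_cong:
  assumes c: "is_chart c" and "open W" "p \<in> fst c" "p \<in> W" and eq: "\<And>q. q \<in> W \<Longrightarrow> f q = g q"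
  shows "jac_det (rep c d f) (snd c p) = jac_det (rep c d g) (snd c p)"
proof -
  have "frechet_derivative (rep c d f) (at (snd c p)) i = frechet_derivative (rep c d g) (at (snd c p)) i" for i
    using iter_deriv_rep_cong[where f = f and g = g, OF assms, where vs = "[i]" and d = d] by (simp add: iter_deriv_Cons)
  then show ?thesis by (simp add: jac_det_def jacobian_def matrix_def)
qed

lemma jac_det_rep_id:
  assumes c: "is_chart c" and p: "p \<in> fst c"
  shows "jac_det (rep c c id) (snd c p) = 1"
proof -
  have "iter_deriv [i] (rep c c id) (snd c p) = iter_deriv [i] (\<lambda>x. x) (snd c p)" for i
    by (rule iter_deriv_cong[OF open_chart_image[OF c open_UNIV]])
      (use p in \<open>auto simp: rep_def is_chart_inv[OF c]\<close>)
  then have "jac_det (rep c c id) (snd c p) = jac_det (\<lambda>x. x) (snd c p)"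
    by (simp add: jac_det_def jacobian_def matrix_def iter_deriv_Cons)
  also have "\<dots> = 1"
    by (simp add: jac_det_def jacobian_def matrix_id_mat_1[unfolded id_def])
  finally show ?thesis .
qed

locale surface_disk =
  fixes A :: "('a::t2_space) chart set" and c0 :: "'a chart"
  assumes smooth_str: "smooth_structure A"
    and c0: "c0 \<in> A" and disk: "cball 0 1 \<subseteq> snd c0 ` fst c0"
begin

lemma charts: "c \<in> A \<Longrightarrow> is_chart c"
  using smooth_str by (simp add: smooth_structure_def)

lemma chart_at: obtains c where "c \<in> A" "p \<in> fst c"
proof -
  have "p \<in> (\<Union>c\<in>A. fst c)" using smooth_str by (simp add: smooth_structure_def)
  then show ?thesis using that by auto
qed

lemma compat: "c \<in> A \<Longrightarrow> d \<in> A \<Longrightarrow> smooth_on (rep_dom c d id) (rep c d id)"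
  using smooth_str by (simp add: smooth_structure_def compatible_def)

abbreviation "back \<equiv> inv_into (fst c0) (snd c0)"

lemma back_coord: "p \<in> fst c0 \<Longrightarrow> back (snd c0 p) = p"
  by (rule is_chart_inv[OF charts[OF c0]])

lemma back_disk:
  assumes "norm y \<le> 1"
  shows "back y \<in> fst c0" "snd c0 (back y) = y"
proof -
  have "y \<in> snd c0 ` fst c0" using assms disk by auto
  then show "back y \<in> fst c0" "snd c0 (back y) = y"
    by (auto intro: inv_into_into f_inv_into_f)
qed

text \<open>The set is the image of a compact disk, hence closed in the Hausdorff space. Closedness
  relative to the chart domain alone would not give this.\<close>

lemma closed_inner:
  assumes "r \<le> 1"
  shows "closed {p \<in> fst c0. norm (snd c0 p) \<le> r}"
proof -
  have "{p \<in> fst c0. norm (snd c0 p) \<le> r} = back ` cball 0 r"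
    using back_coord back_disk assms by (force simp: image_iff)
  moreover have "compact (back ` cball 0 r)"
    using chart_continuous_on(2)[OF charts[OF c0]] disk assms
    by (intro compact_continuous_image) (auto elim!: continuous_on_subset)
  ultimately show ?thesis by (simp add: compact_imp_closed)
qed

lemma open_inner: "open {p \<in> fst c0. norm (snd c0 p) < r}"
proof -
  have "open (fst c0 \<inter> snd c0 -` ball 0 r)"
    by (rule open_chart_vimage[OF charts[OF c0]]) simp
  moreover have "fst c0 \<inter> snd c0 -` ball 0 r = {p \<in> fst c0. norm (snd c0 p) < r}"
    by auto
  ultimately show ?thesis by simp
qed

definition twist :: "(real \<Rightarrow> real) \<Rightarrow> 'a \<Rightarrow> 'a" where
  "twist w p = (if p \<in> chart_disk c0 then back (rot w (snd c0 p)) else p)"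

section \<open>Twists as diffeomorphisms of the surface\<close>

lemma twist_coord:
  assumes "p \<in> chart_disk c0"
  shows "twist w p \<in> chart_disk c0" "snd c0 (twist w p) = rot w (snd c0 p)"
proof -
  have "norm (rot w (snd c0 p)) \<le> 1" using assms by (simp add: chart_disk_def)
  note * = back_disk[OF this]
  show "snd c0 (twist w p) = rot w (snd c0 p)"
    using assms *(2) by (simp add: twist_def)
  then show "twist w p \<in> chart_disk c0"
    using assms * by (simp add: twist_def chart_disk_def)
qed

lemma twist_uminus: "twist (\<lambda>q. - w q) (twist w p) = p"
proof (cases "p \<in> chart_disk c0")
  case True
  have "twist (\<lambda>q. - w q) (twist w p) = back (rot (\<lambda>q. - w q) (snd c0 (twist w p)))"
    unfolding twist_def[of "\<lambda>q. - w q"] by (rule if_P) (rule twist_coord(1)[OF True])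
  also have "\<dots> = back (snd c0 p)"
    by (simp only: twist_coord(2)[OF True] rot_rot_uminus)
  also have "\<dots> = p"
    by (rule back_coord) (use True in \<open>simp add: chart_disk_def\<close>)
  finally show ?thesis .
next
  case False
  then show ?thesis unfolding twist_def by simp
qed

lemma twist_eq_id:
  assumes "p \<in> fst c0 \<Longrightarrow> w (snd c0 p \<bullet> snd c0 p) = 0"
  shows "twist w p = p"
proof (cases "p \<in> chart_disk c0")
  case True
  then have p: "p \<in> fst c0" by (simp add: chart_disk_def)
  then show ?thesis using True by (simp add: twist_def rot_eq_id[of w "snd c0 p", OF assms[OF p]] back_coord)
qed (simp add: twist_def)

text \<open>Since \<open>q\<close> is the squared radius, 1/4 means radius 1/2. The twist is then
  the identity from that radius on, and the overlapping open sets \<open>inner_disk\<close> and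
  \<open>outer_part\<close> allow gluing.\<close>

definition admissible :: "(real \<Rightarrow> real) \<Rightarrow> bool" where
  "admissible w \<longleftrightarrow> smooth_on UNIV w \<and> (\<forall>q\<ge>1/4. w q = 0)"

abbreviation "inner_disk \<equiv> {p \<in> fst c0. norm (snd c0 p) < 1}"
abbreviation "outer_part \<equiv> - {p \<in> fst c0. norm (snd c0 p) \<le> 1/2}"

lemma cover_cases:
  obtains "p \<in> inner_disk" | "p \<in> outer_part"
  by force

lemma open_outer_part: "open outer_part"
  using closed_inner[of "1/2"] by auto

lemma twist_outer:
  assumes "admissible w" "p \<in> outer_part"
  shows "twist w p = p"
proof (rule twist_eq_id)
  assume "p \<in> fst c0"
  then have "norm (snd c0 p) > 1/2" using assms(2) by auto
  then have "norm (snd c0 p) ^ 2 \<ge> (1/2) ^ 2" by (intro power_mono) auto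
  then show "w (snd c0 p \<bullet> snd c0 p) = 0"
    using assms(1) by (auto simp: admissible_def power2_norm_eq_inner power_divide)
qed

lemma continuous_twist:
  assumes w: "admissible w"
  shows "continuous_on UNIV (twist w)"
proof -
  have "continuous_on inner_disk (\<lambda>p. back (rot w (snd c0 p)))"
  proof (rule continuous_on_compose2[OF chart_continuous_on(2)[OF charts[OF c0]]])
    have "continuous_on UNIV (rot w)"
      by (rule smooth_on_imp_continuous_on, rule smooth_rot) (use w in \<open>simp add: admissible_def\<close>)
    moreover have "continuous_on inner_disk (snd c0)"
      by (rule continuous_on_subset[OF chart_continuous_on(1)[OF charts[OF c0]]]) auto
    ultimately show "continuous_on inner_disk (\<lambda>p. rot w (snd c0 p))"
      by (rule continuous_on_compose2) auto
    show "(\<lambda>p. rot w (snd c0 p)) ` inner_disk \<subseteq> snd c0 ` fst c0"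
    proof
      fix y assume "y \<in> (\<lambda>p. rot w (snd c0 p)) ` inner_disk"
      then have "y \<in> cball 0 1" by auto
      then show "y \<in> snd c0 ` fst c0" using disk by blast
    qed
  qed
  then have "continuous_on inner_disk (twist w)"
    by (rule continuous_on_eq) (auto simp: twist_def chart_disk_def)
  moreover have "continuous_on outer_part (twist w)"
    by (rule continuous_on_eq[of _ "\<lambda>p. p"]) (use twist_outer[OF w] in auto)
  ultimately have "continuous_on (inner_disk \<union> outer_part) (twist w)"
    using open_inner open_outer_part by (intro continuous_on_open_Un) auto
  moreover have "inner_disk \<union> outer_part = UNIV" by force
  ultimately show ?thesis by simp
qed

lemma smooth_twist:
  assumes w: "admissible w"
  shows "smooth_map A (twist w)"
  unfolding smooth_map_def
proof (intro conjI ballI continuous_twist w)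
  fix c d assume cd: "c \<in> A" "d \<in> A"
  note c = charts[OF cd(1)] and d = charts[OF cd(2)]
  have od: "open (twist w -` fst d)"
    using continuous_twist[OF w] d by (auto simp: is_chart_def intro: open_vimage)
  show "smooth_on (rep_dom c d (twist w)) (rep c d (twist w))"
  proof (rule smooth_on_local)
    fix x assume "x \<in> rep_dom c d (twist w)"
    then obtain p where p: "p \<in> fst c" "twist w p \<in> fst d" "x = snd c p"
      by (auto simp: rep_dom_def)
    show "\<exists>V. x \<in> V \<and> smooth_on V (rep c d (twist w))"
    proof (cases p rule: cover_cases)
      case 2
      let ?V = "snd c ` (fst c \<inter> (fst d \<inter> outer_part))"
      have V: "open ?V"
        using d by (intro open_chart_image[OF c] open_Int open_outer_part) (auto simp: is_chart_def)
      have "smooth_on ?V (rep c d id)"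
        by (rule smooth_on_subset[OF compat[OF cd]]) (auto simp: rep_dom_def)
      then have "smooth_on ?V (rep c d (twist w))"
      proof (rule smooth_on_cong[OF _ V])
        fix y assume "y \<in> ?V"
        then obtain q where q: "y = snd c q" "q \<in> fst c" "q \<in> outer_part" by blast
        show "rep c d id y = rep c d (twist w) y"
          using q twist_outer[OF w q(3)] by (simp add: rep_def is_chart_inv[OF c])
      qed
      moreover have "x \<in> ?V" using p 2 twist_outer[OF w 2] by (intro image_eqI[of _ _ p]) auto
      ultimately show ?thesis by (intro exI[of _ ?V] conjI)
    next
      case 1
      let ?V = "snd c ` (fst c \<inter> (inner_disk \<inter> twist w -` fst d))"
      have V: "open ?V"
        by (intro open_chart_image[OF c] open_Int open_inner od)
      have coord: "rot w (snd c0 q) = snd c0 (twist w q) \<and> twist w q \<in> fst c0" if "q \<in> inner_disk" for q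
        using twist_coord[of q w] that by (auto simp: chart_disk_def)
      \<comment> \<open>In the disk the local representative factors into the change of coordinates
        from \<open>c\<close> to \<open>c0\<close>, the rotation, and the change from
        \<open>c0\<close> to \<open>d\<close>.\<close>
      have "smooth_on ?V (\<lambda>y. rep c0 d id (rot w (rep c c0 id y)))"
      proof (rule smooth_on_compose[OF V _ _ compat[OF c0 cd(2)]])
        show "open (rep_dom c0 d id)"
          using d by (intro open_rep_dom charts c0) (auto simp: is_chart_def id_def)
        show "(\<lambda>y. rot w (rep c c0 id y)) ` ?V \<subseteq> rep_dom c0 d id"
          using coord by (auto simp: rep_def rep_dom_def is_chart_inv[OF c])
        show "smooth_on ?V (\<lambda>y. rot w (rep c c0 id y))"
        proof (rule smooth_on_compose[OF V, where V = UNIV and f = "rot w" and g = "rep c c0 id"])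
          show "smooth_on UNIV (rot w)"
            by (rule smooth_rot) (use w in \<open>simp add: admissible_def\<close>)
          show "smooth_on ?V (rep c c0 id)"
            by (rule smooth_on_subset[OF compat[OF cd(1) c0]]) (unfold rep_dom_def, rule image_mono, auto)
        qed auto
      qed
      then have "smooth_on ?V (rep c d (twist w))"
      proof (rule smooth_on_cong[OF _ V])
        fix y assume "y \<in> ?V"
        then obtain q where q: "y = snd c q" "q \<in> fst c" "q \<in> inner_disk" by blast
        show "rep c0 d id (rot w (rep c c0 id y)) = rep c d (twist w) y"
          using q coord[OF q(3)] by (simp add: rep_def is_chart_inv[OF c] back_coord)
      qed
      moreover have "x \<in> ?V" using p 1 by (intro image_eqI[of _ _ p]) auto
      ultimately show ?thesis by (intro exI[of _ ?V] conjI)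
    qed
  qed
qed

lemma admissible_uminus:
  assumes "admissible w"
  shows "admissible (\<lambda>q. - w q)"
proof -
  have "Ck k UNIV w" for k
    using assms by (simp add: admissible_def smooth_on_iff_Ck)
  from Ck_bounded_linear[OF bounded_linear_minus[OF bounded_linear_ident] open_UNIV this]
  have "smooth_on UNIV (\<lambda>q. - w q)"
    by (simp add: smooth_on_iff_Ck)
  then show ?thesis using assms by (simp add: admissible_def)
qed

lemma twist_comp: "twist (\<lambda>q. - w q) \<circ> twist w = id" "twist w \<circ> twist (\<lambda>q. - w q) = id"
  using twist_uminus[of "\<lambda>q. - w q"] by (rule_tac ext, simp add: twist_uminus)+

lemma bij_twist: "bij (twist w)"
  using twist_comp by (rule o_bij)

lemma inv_twist: "inv (twist w) = twist (\<lambda>q. - w q)"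
  using twist_comp(2,1) by (rule inv_unique_comp)

lemma twist_Diff: "admissible w \<Longrightarrow> twist w \<in> Diff A"
  by (simp add: Diff_def bij_twist inv_twist smooth_twist admissible_uminus)

section \<open>Twists preserve the Poisson structure\<close>

lemma poisson_bivector_c0:
  assumes "p \<in> chart_disk c0"
  shows "poisson_bivector A c0 chi c0 p = disk_coeff chi (snd c0 p)"
  using assms c0 jac_det_rep_id[OF charts[OF c0], of p]
  by (simp add: poisson_bivector_def chart_disk_def)

text \<open>On the outer part the twist is locally the identity. In the disk it has Jacobian
  determinant 1 in the chart \<open>c0\<close> and preserves the coefficient there; passing to
  another chart \<open>d\<close> contributes the same factor to both sides.\<close>

lemma twist_Poiss:
  assumes w: "admissible w" and inv: "\<And>x. disk_coeff chi (rot w x) = disk_coeff chi x"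
  shows "twist w \<in> Poiss A (poisson_bivector A c0 chi)"
proof -
  let ?P = "poisson_bivector A c0 chi"
  note bv = bivector_field_poisson_bivector[OF smooth_str c0, of chi]
  have "pushforward A (twist w) ?P d q = ?P d q" for d q
  proof (cases "d \<in> A \<and> q \<in> fst d")
    case False
    then have "pushforward A (twist w) ?P d q = 0"
      unfolding pushforward_def by (rule if_not_P)
    moreover have "?P d q = 0"
      using False by (auto simp: poisson_bivector_def)
    ultimately show ?thesis by simp
  next
    case True
    then have d: "d \<in> A" "q \<in> fst d" by auto
    obtain p where p: "q = twist w p" using surjD[OF bij_is_surj[OF bij_twist]] by blast
    note pf = pushforward_eq[OF smooth_str bv twist_Diff[OF w]]
    show ?thesis
    proof (cases p rule: cover_cases)
      case 2
      then have qp: "q = p" using twist_outer[OF w] p by simp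
      have J: "jac_det (rep d d (twist w)) (snd d p) = jac_det (rep d d id) (snd d p)"
        by (rule jac_det_rep_cong[OF charts[OF d(1)] open_outer_part])
          (use d qp 2 twist_outer[OF w] in auto)
      have "pushforward A (twist w) ?P d (twist w p) = jac_det (rep d d (twist w)) (snd d p) * ?P d p"
        by (rule pf) (use d qp p in auto)
      moreover have "?P d p = jac_det (rep d d id) (snd d p) * ?P d p"
        using bv d qp unfolding bivector_field_def by blast
      ultimately show ?thesis using qp p by (simp only: J)
    next
      case 1
      then have pd: "p \<in> chart_disk c0" "p \<in> fst c0" by (auto simp: chart_disk_def)
      then have qd: "q \<in> chart_disk c0" "q \<in> fst c0" "snd c0 q = rot w (snd c0 p)"
        using twist_coord[OF pd(1), of w] p by (auto simp: chart_disk_def)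
      have Pp: "?P c0 p = disk_coeff chi (snd c0 p)"
        by (rule poisson_bivector_c0[OF pd(1)])
      have rot_diff: "rot w differentiable (at x)" for x
        using w smooth_on_differentiable[OF smooth_rot] by (auto simp: admissible_def)
      have eqV: "rot w y = rep c0 c0 (twist w) y" if "y \<in> snd c0 ` (fst c0 \<inter> inner_disk)" for y
        using that twist_coord by (auto simp: rep_def back_coord chart_disk_def)
      have V: "open (snd c0 ` (fst c0 \<inter> inner_disk))"
        by (rule open_chart_image[OF charts[OF c0] open_inner])
      have "jac_det (rep c0 c0 (twist w)) (snd c0 p) = jac_det (rot w) (snd c0 p)"
      proof -
        have "iter_deriv [i] (rep c0 c0 (twist w)) (snd c0 p) = iter_deriv [i] (rot w) (snd c0 p)" for i
          by (rule iter_deriv_cong[OF V]) (use 1 eqV in auto)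
        then show ?thesis by (simp add: jac_det_def jacobian_def matrix_def iter_deriv_Cons)
      qed
      then have J1: "jac_det (rep c0 c0 (twist w)) (snd c0 p) = 1"
        using w by (simp add: jac_det_rot admissible_def)
      have "jac_det (rep c0 d (id \<circ> twist w)) (snd c0 p) =
          jac_det (rep c0 d id) (snd c0 (twist w p)) * jac_det (rep c0 c0 (twist w)) (snd c0 p)"
      proof (rule jac_det_comp[OF charts[OF c0] charts[OF c0] continuous_twist[OF w]])
        show "rep c0 c0 (twist w) differentiable (at (snd c0 p))"
          by (rule differentiable_cong_open[OF rot_diff V _ eqV]) (use 1 in auto)
        have "snd c0 (twist w p) \<in> rep_dom c0 d id"
          unfolding rep_dom_def by (rule imageI) (use d qd p in auto)
        then show "rep c0 d id differentiable (at (snd c0 (twist w p)))"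
          by (rule smooth_on_differentiable[OF compat[OF c0 d(1)]])
      qed (use pd qd p in simp_all)
      then have J2: "jac_det (rep c0 d (twist w)) (snd c0 p) = jac_det (rep c0 d id) (snd c0 q)"
        by (simp only: J1 p id_o mult_1_right)
      have "pushforward A (twist w) ?P d (twist w p) = jac_det (rep c0 d (twist w)) (snd c0 p) * ?P c0 p"
        by (rule pf) (use d p c0 pd in auto)
      also have "\<dots> = jac_det (rep c0 d id) (snd c0 q) * ?P c0 p"
        by (simp only: J2)
      also have "\<dots> = ?P d q"
        using d qd(1) unfolding Pp by (simp add: poisson_bivector_def qd(3) inv)
      finally show ?thesis unfolding p .
    qed
  qed
  then have "pushforward A (twist w) ?P = ?P" by (intro ext)
  then show ?thesis using twist_Diff[OF w] by (simp add: Poiss_def)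
qed

end

section \<open>Twists close to the identity\<close>

lemma isCont_imp_tendsto_nhds: "isCont f a \<Longrightarrow> (f \<longlongrightarrow> f a) (nhds a)"
  by (simp add: isCont_def tendsto_at_iff_tendsto_nhds)

lemma Cinf_subbasicI:
  assumes "smooth_map A g"
    and "\<And>p. p \<in> K \<Longrightarrow> g p \<in> fst d \<and>
      (\<forall>vs. set vs \<subseteq> Basis \<and> length vs \<le> r \<longrightarrow>
        norm (iter_deriv vs (rep c d g) (snd c p) - iter_deriv vs (rep c d f) (snd c p)) < e)"
  shows "g \<in> Cinf_subbasic A r f c d K e"
  using assms unfolding Cinf_subbasic_def by blast

lemma Cinf_subbasicD:
  assumes "g \<in> Cinf_subbasic A r f c d K e"
  shows "smooth_map A g" "\<And>p. p \<in> K \<Longrightarrow> g p \<in> fst d"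
    and "\<And>p vs. p \<in> K \<Longrightarrow> set vs \<subseteq> Basis \<Longrightarrow> length vs \<le> r \<Longrightarrow>
      norm (iter_deriv vs (rep c d g) (snd c p) - iter_deriv vs (rep c d f) (snd c p)) < e"
  using assms unfolding Cinf_subbasic_def by blast+

lemma topspace_Cinf_topology: "g \<in> topspace (Cinf_topology A) \<Longrightarrow> smooth_map A g"
  by (auto simp: Cinf_topology_def Cinf_subbasic_def)

lemma openin_Cinf_subbasic:
  assumes "smooth_map A f" "c \<in> A" "d \<in> A" "compact K" "K \<subseteq> fst c" "f ` K \<subseteq> fst d" "e > 0"
  shows "openin (Cinf_topology A) (Cinf_subbasic A r f c d K e)"
  unfolding Cinf_topology_def by (rule topology_generated_by_Basis) (use assms in blast)

locale surface_cutoff = surface_disk A c0 + cutoff chi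
  for A :: "('a::t2_space) chart set" and c0 chi
begin

abbreviation "center \<equiv> back 0"

lemma center: "center \<in> fst c0" "snd c0 center = 0" "center \<in> chart_disk c0"
  using back_disk[of 0] by (auto simp: chart_disk_def)

lemma admissible_angle:
  assumes "S \<subseteq> {5..}"
  shows "admissible (angle S)"
  unfolding admissible_def
proof (intro conjI allI impI smooth_angle assms)
  fix q :: real assume "1/4 \<le> q"
  then have "1/q \<le> 1/(1/4)" by (intro divide_left_mono) auto
  then show "angle S q = 0" by (intro angle_eq_zero[OF assms]) auto
qed

lemma twist_far:
  assumes S: "S \<subseteq> {n0..}" "5 \<le> n0" and r: "r > 0" "1 / r\<^sup>2 < real n0 ^ 2 - 4"
    and p: "p \<in> - {p \<in> fst c0. norm (snd c0 p) \<le> r}"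
  shows "twist (angle S) p = p"
proof (rule twist_eq_id)
  assume "p \<in> fst c0"
  then have "r < norm (snd c0 p)" using p by auto
  then have "r\<^sup>2 \<le> (norm (snd c0 p))\<^sup>2" using r by (intro power_mono) auto
  then have "1 / (snd c0 p \<bullet> snd c0 p) \<le> 1 / r\<^sup>2"
    using r by (intro divide_left_mono mult_pos_pos) (auto simp: power2_norm_eq_inner intro: less_le_trans)
  then show "angle S (snd c0 p \<bullet> snd c0 p) = 0"
    using r by (intro angle_eq_zero[OF S]) linarith
qed

lemma twist_cong:
  assumes "\<And>x. snd c0 p = x \<Longrightarrow> v (x \<bullet> x) = w (x \<bullet> x)"
  shows "twist v p = twist w p"
  using assms[OF refl] by (simp add: twist_def rot_def)

lemma open_norm_vimage:
  assumes "open J"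
  shows "open (fst c0 \<inter> snd c0 -` {x. x \<bullet> x \<in> J})"
proof (rule open_chart_vimage[OF charts[OF c0]])
  have "open ((\<lambda>x :: real^2. x \<bullet> x) -` J)"
    by (rule open_vimage[OF assms]) (auto intro!: continuous_intros)
  then show "open {x :: real^2. x \<bullet> x \<in> J}" by (simp add: vimage_def)
qed

text \<open>Away from the center the radius is locally bounded below, so the dichotomy for angles
  near a positive \<open>q\<close> transfers to twists. On the outer part every such twist is the
  identity.\<close>

lemma twist_local_cases:
  assumes S: "S \<subseteq> T" "T \<subseteq> {5..}" and p: "p \<noteq> center"
  obtains W where "open W" "p \<in> W"
    "(\<forall>q\<in>W. twist (angle S) q = twist (angle T) q) \<or> (\<forall>q\<in>W. twist (angle S) q = id q)"
proof (cases p rule: cover_cases)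
  case 2
  have "admissible (angle S)" using S by (intro admissible_angle) auto
  then show ?thesis using that[OF open_outer_part 2] twist_outer by auto
next
  case 1
  have "snd c0 p \<noteq> 0" using 1 p back_coord[of p] by auto
  then have "0 < snd c0 p \<bullet> snd c0 p" by simp
  then obtain J where J: "open J" "snd c0 p \<bullet> snd c0 p \<in> J"
    "(\<forall>y\<in>J. angle S y = angle T y) \<or> (\<forall>y\<in>J. angle S y = 0)"
    using angle_local_cases[OF _ S] by blast
  have "(\<forall>q\<in>fst c0 \<inter> snd c0 -` {x. x \<bullet> x \<in> J}. twist (angle S) q = twist (angle T) q) \<or>
      (\<forall>q\<in>fst c0 \<inter> snd c0 -` {x. x \<bullet> x \<in> J}. twist (angle S) q = id q)"
    using J(3)
  proof
    assume "\<forall>y\<in>J. angle S y = angle T y"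
    then have "\<forall>q\<in>fst c0 \<inter> snd c0 -` {x. x \<bullet> x \<in> J}. twist (angle S) q = twist (angle T) q"
      by (intro ballI twist_cong) auto
    then show ?thesis ..
  next
    assume "\<forall>y\<in>J. angle S y = 0"
    then have "\<forall>q\<in>fst c0 \<inter> snd c0 -` {x. x \<bullet> x \<in> J}. twist (angle S) q = q"
      by (intro ballI twist_eq_id) auto
    then show ?thesis by simp
  qed
  then show ?thesis using that[OF open_norm_vimage[OF J(1)]] J(2) 1 by auto
qed

lemma twist_center: "twist (angle S) center = center"
  by (rule twist_eq_id) (simp add: center angle_nonpos)

lemma smooth_rep_angle:
  assumes "S \<subseteq> {5..}" "c \<in> A" "d \<in> A"
  shows "smooth_on (rep_dom c d (twist (angle S))) (rep c d (twist (angle S)))"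
  using smooth_twist[OF admissible_angle[OF assms(1)]] assms(2,3) by (simp add: smooth_map_def)

text \<open>Derivatives in an arbitrary chart \<open>c\<close> around the center will be followed as
  functions of the coordinate \<open>y\<close> of \<open>c0\<close>, where the center is
  \<open>y = 0\<close> and the twist depends on the radius in a simple way.\<close>

lemma continuous_center_chart:
  assumes "c \<in> A" "center \<in> fst c"
  shows "isCont (\<lambda>y. snd c (back y)) 0" "\<forall>\<^sub>F y in nhds 0. back y \<in> fst c \<inter> fst c0"
proof -
  have dom: "0 \<in> rep_dom c0 c id"
    using assms center by (force simp: rep_dom_def)
  have "isCont (iter_deriv [] (rep c0 c id)) 0"
    by (rule continuous_iter_deriv[OF compat[OF c0 assms(1)] _ dom]) simp
  then show "isCont (\<lambda>y. snd c (back y)) 0" by (simp add: rep_def o_def)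
  have "open (rep_dom c0 c id)"
    using charts[OF assms(1)] by (intro open_rep_dom charts c0) (auto simp: is_chart_def id_def)
  then have "\<forall>\<^sub>F y in nhds 0. y \<in> rep_dom c0 c id"
    using dom by (rule eventually_nhds_in_open)
  then show "\<forall>\<^sub>F y in nhds 0. back y \<in> fst c \<inter> fst c0"
    by eventually_elim (auto simp: rep_dom_def back_coord)
qed

lemma isCont_center_deriv:
  assumes "smooth_on (rep_dom c d f) (rep c d f)" "c \<in> A" "center \<in> fst c" "f center \<in> fst d"
    and vs: "set vs \<subseteq> Basis"
  shows "isCont (\<lambda>y. iter_deriv vs (rep c d f) (snd c (back y))) 0"
proof (rule isCont_o2[OF continuous_center_chart(1)])
  show "isCont (iter_deriv vs (rep c d f)) (snd c center)"
    by (rule continuous_iter_deriv[OF assms(1) vs]) (use assms in \<open>auto simp: rep_dom_def\<close>)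
qed (use assms in auto)

text \<open>
  The regions between the rings, where the twist is the identity, accumulate at the center; by
  continuity all derivatives of the twist at the center are those of the identity.
\<close>

lemma twist_flat:
  assumes S: "S \<subseteq> {5..}" and cd: "c \<in> A" "d \<in> A" and O: "center \<in> fst c" "center \<in> fst d"
    and vs: "set vs \<subseteq> Basis"
  shows "iter_deriv vs (rep c d (twist (angle S))) (snd c center) = iter_deriv vs (rep c d id) (snd c center)"
proof (rule ccontr)
  assume ne: "\<not> ?thesis"
  let ?g = "\<lambda>y. iter_deriv vs (rep c d (twist (angle S))) (snd c (back y)) - iter_deriv vs (rep c d id) (snd c (back y))"
  have "isCont ?g 0"
    by (intro isCont_diff isCont_center_deriv smooth_rep_angle S compat cd vs)
      (use O in \<open>auto simp: twist_center\<close>)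
  then have "(?g \<longlongrightarrow> ?g 0) (nhds 0)"
    by (rule isCont_imp_tendsto_nhds)
  then have "\<forall>\<^sub>F y in nhds 0. ?g y \<noteq> 0"
    by (rule tendsto_imp_eventually_ne) (use ne in simp)
  then have "\<forall>\<^sub>F y in nhds 0. ?g y \<noteq> 0 \<and> back y \<in> fst c \<inter> fst c0"
    using continuous_center_chart(2)[OF cd(1) O(1)] by eventually_elim auto
  then obtain \<delta> where \<delta>: "\<delta> > 0" "\<And>y. norm y < \<delta> \<Longrightarrow> ?g y \<noteq> 0 \<and> back y \<in> fst c \<inter> fst c0"
    by (auto simp: eventually_nhds_metric)
  \<comment> \<open>As \<open>q\<close> is a squared radius, a point \<open>y\<close> with
    \<open>y \<bullet> y = q\<close> then has norm below both \<open>\<delta>\<close> and 1.\<close>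
  obtain q J where q: "0 < q" "q < (min \<delta> 1)\<^sup>2" "open J" "q \<in> J" "\<And>y. y \<in> J \<Longrightarrow> angle S y = 0"
  proof (rule angle_gaps[OF _ S])
    show "0 < (min \<delta> 1)\<^sup>2" using \<delta>(1) by (auto simp: zero_less_power2)
  qed (rule that)
  define y :: "real^2" where "y = sqrt q *\<^sub>R axis 1 1"
  have ny: "norm y = sqrt q" using q by (simp add: y_def)
  have "sqrt q < min \<delta> 1" using q \<delta>(1) by (intro real_less_lsqrt) auto
  then have y: "norm y < \<delta>" "norm y \<le> 1" using ny by auto
  have yy: "y \<bullet> y = q" using ny q by (simp flip: power2_norm_eq_inner)
  let ?W = "fst c0 \<inter> snd c0 -` {x. x \<bullet> x \<in> J}"
  have "iter_deriv vs (rep c d (twist (angle S))) (snd c (back y)) = iter_deriv vs (rep c d id) (snd c (back y))"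
  proof (rule iter_deriv_rep_cong[OF charts[OF cd(1)] open_norm_vimage[OF q(3)]])
    show "back y \<in> fst c" using \<delta>(2)[OF y(1)] by blast
    show "back y \<in> ?W" using back_disk[OF y(2)] yy q(4) by simp
    show "twist (angle S) p = id p" if "p \<in> ?W" for p
      using that q(5) by (simp add: twist_eq_id)
  qed
  then show False using \<delta>(2)[OF y(1)] by simp
qed

text \<open>The bounds hold for the identity on \<open>K\<close>, hence by flatness and continuity
  also for the single map \<open>?F\<close> on \<open>K\<close> near the center. If \<open>S\<close>
  has only large elements, its twist is the identity outside that small disk. Inside it, away from
  the center, it agrees locally with \<open>?F\<close> or the identity, and at the center its
  derivatives are those of the identity.\<close>

lemma twist_in_Cinf_subbasic:
  assumes f: "smooth_map A f" and cd: "c \<in> A" "d \<in> A" and K: "compact K" "K \<subseteq> fst c" "f ` K \<subseteq> fst d"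
    and id: "id \<in> Cinf_subbasic A r f c d K e"
  shows "\<exists>n0\<ge>5. \<forall>S\<subseteq>{n0..}. twist (angle S) \<in> Cinf_subbasic A r f c d K e"
proof -
  let ?F = "twist (angle {5..})"
  let ?V = "{vs :: (real^2) list. set vs \<subseteq> Basis \<and> length vs \<le> r}"
  note idK = Cinf_subbasicD(2)[OF id, simplified]
  note idD = Cinf_subbasicD(3)[OF id]
  \<comment> \<open>If the center is not in \<open>K\<close>, the small disk is chosen to avoid
    \<open>K\<close> altogether.\<close>
  define Q where "Q y \<longleftrightarrow> (if center \<in> K then back y \<in> fst d \<and> (\<forall>vs\<in>?V.
      norm (iter_deriv vs (rep c d ?F) (snd c (back y)) - iter_deriv vs (rep c d f) (snd c (back y))) < e)
      else back y \<notin> K)" for y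
  have "\<forall>\<^sub>F y in nhds 0. Q y"
  proof (cases "center \<in> K")
    case True
    then have O: "center \<in> fst c" "center \<in> fst d" "f center \<in> fst d" using K idK by auto
    have "finite ?V" by (rule finite_lists_length_le) simp
    moreover have "\<forall>\<^sub>F y in nhds 0.
        norm (iter_deriv vs (rep c d ?F) (snd c (back y)) - iter_deriv vs (rep c d f) (snd c (back y))) < e"
      if vs: "vs \<in> ?V" for vs
    proof -
      let ?g = "\<lambda>y. norm (iter_deriv vs (rep c d ?F) (snd c (back y)) - iter_deriv vs (rep c d f) (snd c (back y)))"
      have "isCont ?g 0"
      proof (intro isCont_norm isCont_diff isCont_center_deriv smooth_rep_angle cd)
        show "smooth_on (rep_dom c d f) (rep c d f)" using f cd by (simp add: smooth_map_def)
      qed (use O vs in \<open>auto simp: twist_center\<close>)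
      then have "(?g \<longlongrightarrow> ?g 0) (nhds 0)"
        by (rule isCont_imp_tendsto_nhds)
      moreover have "?g 0 < e"
        using idD[OF True, of vs] vs twist_flat[OF _ cd O(1,2), of "{5..}" vs] by auto
      ultimately show ?thesis
        by (rule order_tendstoD(2))
    qed
    ultimately have "\<forall>\<^sub>F y in nhds 0. \<forall>vs\<in>?V.
        norm (iter_deriv vs (rep c d ?F) (snd c (back y)) - iter_deriv vs (rep c d f) (snd c (back y))) < e"
      by (intro eventually_ball_finite) auto
    then show ?thesis
      using continuous_center_chart(2)[OF cd(2) O(2)]
      by eventually_elim (use True in \<open>auto simp: Q_def\<close>)
  next
    case False
    have "open (fst c0 \<inter> - K)"
      using K(1) charts[OF c0] by (auto simp: is_chart_def intro!: open_Int open_Compl compact_imp_closed)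
    then have "open (snd c0 ` (fst c0 \<inter> (fst c0 \<inter> - K)))"
      by (rule open_chart_image[OF charts[OF c0]])
    then have "\<forall>\<^sub>F y in nhds 0. y \<in> snd c0 ` (fst c0 \<inter> (fst c0 \<inter> - K))"
      by (rule eventually_nhds_in_open) (use False center in force)
    then show ?thesis
      by eventually_elim (use False in \<open>auto simp: Q_def back_coord\<close>)
  qed
  then obtain \<rho>' where \<rho>': "\<rho>' > 0" "\<And>y. norm y < \<rho>' \<Longrightarrow> Q y"
    by (auto simp: eventually_nhds_metric)
  \<comment> \<open>Halving makes the closed disk of radius \<open>\<rho>\<close> fit into the open
    disk where \<open>Q\<close> holds, and into the chart disk.\<close>
  define \<rho> where "\<rho> = min \<rho>' 1 / 2"
  have \<rho>: "\<rho> > 0" "\<rho> < \<rho>'" "\<rho> \<le> 1" using \<rho>'(1) by (auto simp: \<rho>_def)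
  obtain n1 where n1: "real n1 > 1 / \<rho>\<^sup>2 + 4" using reals_Archimedean2 by blast
  define n0 where "n0 = max 5 n1"
  have "real n0 * 1 \<le> real n0 ^ 2"
    unfolding power2_eq_square by (rule mult_left_mono) (auto simp: n0_def)
  moreover have "real n1 \<le> real n0" "5 \<le> n0" by (auto simp: n0_def)
  ultimately have n0: "5 \<le> n0" "1 / \<rho>\<^sup>2 < real n0 ^ 2 - 4"
    using n1 by linarith+
  have "twist (angle S) \<in> Cinf_subbasic A r f c d K e" if S: "S \<subseteq> {n0..}" for S
  proof (rule Cinf_subbasicI)
    have S5: "S \<subseteq> {5..}" using S n0 by auto
    show "smooth_map A (twist (angle S))" by (rule smooth_twist[OF admissible_angle[OF S5]])
    fix p assume p: "p \<in> K"
    then have pc: "p \<in> fst c" using K by auto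
    let ?G = "\<lambda>g vs. norm (iter_deriv vs (rep c d g) (snd c p) - iter_deriv vs (rep c d f) (snd c p)) < e"
    have *: "?G (twist (angle S)) vs"
      if "open W" "p \<in> W" "\<And>q. q \<in> W \<Longrightarrow> twist (angle S) q = g q" "?G g vs" for W g vs
      using iter_deriv_rep_cong[where vs = vs and d = d and f = "twist (angle S)" and g = g,
          OF charts[OF cd(1)] that(1) pc that(2,3)] that(4) by simp
    show "twist (angle S) p \<in> fst d \<and>
      (\<forall>vs. set vs \<subseteq> Basis \<and> length vs \<le> r \<longrightarrow> ?G (twist (angle S)) vs)"
    proof (cases "p \<in> - {p \<in> fst c0. norm (snd c0 p) \<le> \<rho>}")
      case True
      let ?W = "- {p \<in> fst c0. norm (snd c0 p) \<le> \<rho>}"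
      have W: "open ?W" using closed_inner[OF \<rho>(3)] by (rule open_Compl)
      have far: "twist (angle S) q = id q" if "q \<in> ?W" for q
        using twist_far[OF S n0(1) \<rho>(1) n0(2) that] by simp
      have "?G (twist (angle S)) vs" if "set vs \<subseteq> Basis" "length vs \<le> r" for vs
        by (rule *[OF W True far idD[OF p that]])
      then show ?thesis using far[OF True] idK[OF p] by simp
    next
      case False
      then have p0: "p \<in> fst c0" "norm (snd c0 p) < \<rho>'" "p = back (snd c0 p)" "p \<in> chart_disk c0"
        using \<rho> back_coord by (auto simp: chart_disk_def)
      then have Op: "center \<in> K"
        using \<rho>'(2)[OF p0(2)] p by (auto simp: Q_def split: if_splits)
      \<comment> \<open>The twist preserves the radius, so \<open>Q\<close> also holds at the
        coordinates of the image point and places that point in the domain of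
        \<open>d\<close>.\<close>
      have "twist (angle S) p = back (rot (angle S) (snd c0 p))"
        using p0(4) by (simp add: twist_def)
      moreover have "Q (rot (angle S) (snd c0 p))"
        by (rule \<rho>'(2)) (use p0(2) in simp)
      ultimately have d: "twist (angle S) p \<in> fst d" using Op by (simp add: Q_def)
      have F: "?G ?F vs" if "set vs \<subseteq> Basis" "length vs \<le> r" for vs
        using \<rho>'(2)[OF p0(2)] Op that p0(3) by (simp add: Q_def)
      have "?G (twist (angle S)) vs" if vs: "set vs \<subseteq> Basis" "length vs \<le> r" for vs
      proof (cases "p = center")
        case True
        then show ?thesis
          using twist_flat[OF S5 cd _ _ vs(1)] idD[OF p vs] pc idK[OF p] by simp
      next
        case False
        obtain W where W: "open W" "p \<in> W"
          "(\<forall>q\<in>W. twist (angle S) q = ?F q) \<or> (\<forall>q\<in>W. twist (angle S) q = id q)"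
          using twist_local_cases[OF S5 order_refl False] by blast
        from W(3) show ?thesis
        proof
          assume "\<forall>q\<in>W. twist (angle S) q = ?F q"
          then show ?thesis by (intro *[OF W(1,2) _ F[OF vs]]) auto
        next
          assume "\<forall>q\<in>W. twist (angle S) q = id q"
          then show ?thesis by (intro *[OF W(1,2) _ idD[OF p vs]]) auto
        qed
      qed
      then show ?thesis using d by blast
    qed
  qed
  then show ?thesis using n0(1) by blast
qed

text \<open>Induction over the generation of the topology: finite intersections are handled by the
  maximum of the thresholds, unions by a member that contains the identity.\<close>

lemma twist_in_neighbourhood:
  assumes "openin (Cinf_topology A) V" "id \<in> V"
  shows "\<exists>n0\<ge>5. \<forall>S\<subseteq>{n0..}. twist (angle S) \<in> V"
proof -
  let ?B = "{Cinf_subbasic A r f c d K e | r f c d K e.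
        smooth_map A f \<and> c \<in> A \<and> d \<in> A \<and> compact K \<and> K \<subseteq> fst c \<and> f ` K \<subseteq> fst d \<and> e > 0}"
  have "generate_topology_on ?B V"
    using assms(1) unfolding Cinf_topology_def openin_topology_generated_by_iff .
  then show ?thesis using assms(2)
  proof (induction V rule: generate_topology_on.induct)
    case Empty
    then show ?case by simp
  next
    case (Int a b)
    then obtain m n where mn: "m \<ge> 5" "\<forall>S\<subseteq>{m..}. twist (angle S) \<in> a" "\<forall>S\<subseteq>{n..}. twist (angle S) \<in> b"
      by blast
    have "\<forall>S\<subseteq>{max m n..}. twist (angle S) \<in> a \<inter> b"
    proof (intro allI impI)
      fix S assume "S \<subseteq> {max m n..}"
      then have "S \<subseteq> {m..}" "S \<subseteq> {n..}" by auto
      then show "twist (angle S) \<in> a \<inter> b" using mn by blast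
    qed
    then show ?case using mn(1) by (intro exI[of _ "max m n"]) auto
  next
    case (UN K)
    then show ?case by (metis UnionE UnionI)
  next
    case (Basis s)
    then obtain r f c d K e where s: "s = Cinf_subbasic A r f c d K e" "smooth_map A f" "c \<in> A" "d \<in> A"
      "compact K" "K \<subseteq> fst c" "f ` K \<subseteq> fst d"
      by blast
    show ?case
      using Basis.prems unfolding s(1) by (rule twist_in_Cinf_subbasic[OF s(2-7)])
  qed
qed

section \<open>Paths of Poisson diffeomorphisms\<close>

text \<open>Subbasic sets of order 0 over the one-point compact set \<open>{p}\<close> already
  control the value at \<open>p\<close>.\<close>

lemma continuous_map_evaluation: "continuous_map (Cinf_topology A) euclidean (\<lambda>g. g p)"
  unfolding continuous_map_def
proof (intro conjI allI impI)
  fix W :: "'a set" assume "openin euclidean W"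
  then have W: "open W" by simp
  show "openin (Cinf_topology A) {g \<in> topspace (Cinf_topology A). g p \<in> W}"
  proof (subst openin_subopen, intro ballI)
    fix g0 assume "g0 \<in> {g \<in> topspace (Cinf_topology A). g p \<in> W}"
    then have g0: "smooth_map A g0" "g0 p \<in> W" using topspace_Cinf_topology by auto
    obtain c where c: "c \<in> A" "p \<in> fst c" by (rule chart_at)
    obtain d where d: "d \<in> A" "g0 p \<in> fst d" by (rule chart_at)
    have "open (snd d ` (fst d \<inter> W))" by (rule open_chart_image[OF charts[OF d(1)] W])
    moreover have "snd d (g0 p) \<in> snd d ` (fst d \<inter> W)" using d g0 by simp
    ultimately obtain e where e: "e > 0" "ball (snd d (g0 p)) e \<subseteq> snd d ` (fst d \<inter> W)"
      by (rule openE)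
    let ?N = "Cinf_subbasic A 0 g0 c d {p} e"
    have N: "openin (Cinf_topology A) ?N"
      by (rule openin_Cinf_subbasic) (use g0 c d e in auto)
    have "g0 \<in> ?N" by (rule Cinf_subbasicI) (use g0 d e in auto)
    moreover have "?N \<subseteq> {g \<in> topspace (Cinf_topology A). g p \<in> W}"
    proof
      fix g assume g: "g \<in> ?N"
      have gd: "g p \<in> fst d" using Cinf_subbasicD(2)[OF g] by simp
      have "norm (snd d (g p) - snd d (g0 p)) < e"
        using Cinf_subbasicD(3)[OF g, of p "[]"] by (simp add: rep_def is_chart_inv[OF charts[OF c(1)] c(2)])
      then have "snd d (g p) \<in> ball (snd d (g0 p)) e"
        by (simp add: dist_norm norm_minus_commute)
      then have "snd d (g p) \<in> snd d ` (fst d \<inter> W)" using e(2) by (rule subsetD[rotated])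
      then obtain q where q: "q \<in> fst d" "q \<in> W" "snd d (g p) = snd d q" by blast
      then have "g p = q"
        using is_chart_inv[OF charts[OF d(1)] gd] is_chart_inv[OF charts[OF d(1)] q(1)] by metis
      then show "g \<in> {g \<in> topspace (Cinf_topology A). g p \<in> W}"
        using q(2) openin_subset[OF N] g by auto
    qed
    ultimately show "\<exists>T. openin (Cinf_topology A) T \<and> g0 \<in> T \<and> T \<subseteq> {g \<in> topspace (Cinf_topology A). g p \<in> W}"
      using N by blast
  qed
qed auto

abbreviation "P \<equiv> poisson_bivector A c0 chi"

text \<open>The chain rule for \<open>inv \<phi> \<circ> \<phi>\<close> shows that the Jacobian
  determinant of \<open>\<phi>\<close> is nonzero. So invariance makes the coefficient at
  \<open>\<phi> p\<close> a nonzero multiple of the nonzero coefficient at \<open>p\<close>.\<close>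

lemma Poiss_nonzero:
  assumes \<phi>: "\<phi> \<in> Poiss A P" and p: "p \<in> chart_disk c0" "disk_coeff chi (snd c0 p) \<noteq> 0"
  shows "\<phi> p \<in> chart_disk c0 \<and> disk_coeff chi (snd c0 (\<phi> p)) \<noteq> 0"
proof -
  have D: "\<phi> \<in> Diff A" and push: "pushforward A \<phi> P = P" using \<phi> by (auto simp: Poiss_def)
  have sm: "smooth_map A \<phi>" "smooth_map A (inv \<phi>)" "inv \<phi> \<circ> \<phi> = id"
    using D by (auto simp: Diff_def bij_def)
  obtain d where d: "d \<in> A" "\<phi> p \<in> fst d" by (rule chart_at)
  have p0: "p \<in> fst c0" using p by (simp add: chart_disk_def)
  have ip: "inv \<phi> (\<phi> p) = p" using sm(3) by (metis comp_apply id_apply)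
  have "jac_det (rep c0 c0 (inv \<phi> \<circ> \<phi>)) (snd c0 p) =
      jac_det (rep d c0 (inv \<phi>)) (snd d (\<phi> p)) * jac_det (rep c0 d \<phi>) (snd c0 p)"
  proof (rule jac_det_comp[where f = \<phi> and g = "inv \<phi>" and e = c0, OF charts[OF c0] charts[OF d(1)] _ p0 d(2)])
    show "continuous_on UNIV \<phi>" using sm by (simp add: smooth_map_def)
    show "rep c0 d \<phi> differentiable (at (snd c0 p))"
      by (rule smooth_on_differentiable[of "rep_dom c0 d \<phi>"])
        (use sm c0 d p0 in \<open>auto simp: smooth_map_def rep_dom_def\<close>)
    show "rep d c0 (inv \<phi>) differentiable (at (snd d (\<phi> p)))"
      by (rule smooth_on_differentiable[of "rep_dom d c0 (inv \<phi>)"])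
        (use sm c0 d p0 ip in \<open>auto simp: smooth_map_def rep_dom_def\<close>)
  qed
  then have "jac_det (rep c0 d \<phi>) (snd c0 p) \<noteq> 0"
    using jac_det_rep_id[OF charts[OF c0] p0] sm(3) by auto
  moreover have "P d (\<phi> p) = jac_det (rep c0 d \<phi>) (snd c0 p) * disk_coeff chi (snd c0 p)"
    using pushforward_eq[OF smooth_str bivector_field_poisson_bivector[OF smooth_str c0, of chi] D c0 d(1) p0 d(2)]
    unfolding push poisson_bivector_c0[OF p(1)] .
  ultimately have "P d (\<phi> p) \<noteq> 0" using p(2) by simp
  then show ?thesis unfolding poisson_bivector_def by (auto split: if_splits)
qed

text \<open>Along a path, the image of the center \<open>pt n 1\<close> moves continuously and stays
  where the coefficient is nonzero, inside a union of disjoint open disks. It would have to go from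
  \<open>pt n 2\<close> to \<open>pt n 1\<close>, the centers of two different disks.\<close>

lemma not_path_component:
  assumes S: "S \<subseteq> {5..}" and T: "T \<subseteq> {5..}" and n: "n \<in> S" "n \<notin> T"
  shows "\<not> path_component_of (Poiss_topology A P) (twist (angle S)) (twist (angle T))"
proof
  assume "path_component_of (Poiss_topology A P) (twist (angle S)) (twist (angle T))"
  then obtain g where g: "pathin (Poiss_topology A P) g" "g 0 = twist (angle S)" "g 1 = twist (angle T)"
    by (auto simp: path_component_of_def)
  have n4: "4 \<le> n" using S n by auto
  define p where "p = back (pt n 1)"
  have "norm (pt n 1) \<le> 1" using n4 by simp
  note p = back_disk[OF this, folded p_def]
  have pd: "p \<in> chart_disk c0" using p n4 by (simp add: chart_disk_def)
  have two: "(2::nat) \<le> 2 ^ n" using n4 power_increasing[of 1 n "2::nat"] by simp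
  have nz: "disk_coeff chi (snd c0 p) \<noteq> 0"
    unfolding p(2) by (rule disk_coeff_pt[OF n4]) simp
  have cont: "continuous_map (top_of_set {0..1}) (Poiss_topology A P) g"
    using g(1) by (simp add: pathin_def)
  have gP: "g t \<in> Poiss A P" if "t \<in> {0..1}" for t
    using cont that by (auto simp: continuous_map_def Poiss_topology_def)
  have "continuous_map (top_of_set {0..1}) (Cinf_topology A) g"
    using cont unfolding Poiss_topology_def by (simp add: continuous_map_in_subtopology)
  from continuous_map_compose[OF this continuous_map_evaluation[of p]]
  have h: "continuous_on {0..1} (\<lambda>t. g t p)"
    by (simp add: o_def)
  have gd: "g t p \<in> chart_disk c0 \<and> disk_coeff chi (snd c0 (g t p)) \<noteq> 0" if "t \<in> {0..1}" for t
    by (rule Poiss_nonzero[OF gP[OF that] pd nz])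
  let ?k = "\<lambda>t. snd c0 (g t p)"
  have "continuous_on {0..1} ?k"
    by (rule continuous_on_compose2[OF chart_continuous_on(1)[OF charts[OF c0]] h])
      (use gd in \<open>auto simp: chart_disk_def\<close>)
  then have conn: "connected (?k ` {0..1})"
    by (intro connected_continuous_image) auto
  \<comment> \<open>The disk of the starting point against the union of all the others: disjoint
    open sets that cover the connected curve and both meet it.\<close>
  let ?U = "ring_ball (n, 2)" and ?V = "\<Union>i\<in>ring_index - {(n, 2)}. ring_ball i"
  have i2: "(n, 2) \<in> ring_index" and i1: "(n, 1) \<in> ring_index"
    using n4 two by (auto simp: ring_index_def)
  have k0: "?k 0 = pt n 2" and k1: "?k 1 = pt n 1"
    using twist_coord(2)[OF pd] p(2) rot_pt[OF S n4, of 1] rot_pt[OF T n4, of 1] n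
    by (auto simp: g numeral_2_eq_2)
  have "?k 0 \<in> ?U" "?k 1 \<in> ring_ball (n, 1)"
    unfolding k0 k1 using n4 by (auto simp: ring_ball_iff rad_pos)
  then have ends: "?U \<inter> ?k ` {0..1} \<noteq> {}" "?V \<inter> ?k ` {0..1} \<noteq> {}"
    using i1 by force+
  have sub: "?k ` {0..1} \<subseteq> ?U \<union> ?V"
  proof
    fix y assume "y \<in> ?k ` {0..1}"
    then have "disk_coeff chi y \<noteq> 0" using gd by blast
    then show "y \<in> ?U \<union> ?V" using disk_coeff_nonzero[of y] by blast
  qed
  have disj: "?U \<inter> ?V \<inter> ?k ` {0..1} = {}"
    using ring_ball_disjoint[OF i2] by blast
  have "open ?U" "open ?V" by (auto simp: ring_ball_def)
  then show False using connectedD[OF conn _ _ disj sub] ends by blast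
qed

lemma path_component_twist_inj:
  assumes S: "S \<subseteq> {5..}" and T: "T \<subseteq> {5..}"
    and "path_component_of (Poiss_topology A P) (twist (angle S)) (twist (angle T))"
  shows "S = T"
proof (rule ccontr)
  assume "S \<noteq> T"
  then consider n where "n \<in> S" "n \<notin> T" | n where "n \<in> T" "n \<notin> S" by blast
  then show False
  proof cases
    case 1
    from not_path_component[OF S T 1] assms(3) show False by contradiction
  next
    case 2
    from not_path_component[OF T S 2] path_component_of_sym[OF assms(3)] show False by contradiction
  qed
qed

end

text \<open>An enumeration of the power set by natural numbers, shifted by \<open>n0\<close>, would
  be a surjection from \<open>{n0..}\<close> onto its own power set, against Cantor's
  theorem.\<close>

lemma uncountable_Pow_atLeast: "uncountable (Pow {n0::nat..})"
proof
  assume "countable (Pow {n0..})"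
  then have "range (from_nat_into (Pow {n0..})) = Pow {n0..}"
    by (intro range_from_nat_into) auto
  moreover have "(\<lambda>k. k - n0) ` {n0..} = UNIV"
    by (auto simp: image_iff intro!: bexI[of _ "_ + n0"])
  ultimately have "(from_nat_into (Pow {n0..}) \<circ> (\<lambda>k. k - n0)) ` {n0..} = Pow {n0..}"
    by (simp only: image_comp[symmetric])
  then show False using Cantors_theorem by blast
qed

theorem corollary5:
  fixes A :: "('a::t2_space) chart set"
    and c0 :: "'a chart"
    and chi :: "real \<Rightarrow> real"
    and N :: "('a \<Rightarrow> 'a) set"
  defines "P \<equiv> poisson_bivector A c0 chi"
  assumes surface: "compact_surface A"
    and chart: "c0 \<in> A" "cball 0 1 \<subseteq> snd c0 ` fst c0"
    and chi_smooth: "smooth_on UNIV chi"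
    and chi_range: "\<And>t. chi t \<in> {0..1}"
    and chi_zero: "\<And>t. \<bar>t\<bar> \<ge> 1 \<Longrightarrow> chi t = 0"
    and chi_pos: "\<And>t. 1/2 < \<bar>t\<bar> \<Longrightarrow> \<bar>t\<bar> < 1 \<Longrightarrow> chi t > 0"
    and chi_one: "\<And>t. \<bar>t\<bar> \<le> 1/2 \<Longrightarrow> chi t = 1"
    and nbhd: "N \<subseteq> Poiss A P"
      "\<exists>U. openin (Poiss_topology A P) U \<and> id \<in> U \<and> U \<subseteq> N"
  shows "uncountable {C \<in> path_components_of (Poiss_topology A P). C \<inter> N \<noteq> {}}"
proof -
  interpret surface_cutoff A c0 chi
    using surface chart chi_smooth chi_range chi_zero chi_one
    by unfold_locales (auto simp: compact_surface_def)
  let ?X = "Poiss_topology A P"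
  obtain U where U: "openin ?X U" "id \<in> U" "U \<subseteq> N" using nbhd(2) by blast
  then obtain V where V: "openin (Cinf_topology A) V" "U = V \<inter> Poiss A P"
    unfolding Poiss_topology_def openin_subtopology by blast
  then obtain n0 where n0: "n0 \<ge> 5" "\<And>S. S \<subseteq> {n0..} \<Longrightarrow> twist (angle S) \<in> V"
    using twist_in_neighbourhood[OF V(1)] U(2) by blast
  have S5: "S \<subseteq> {5..}" if "S \<subseteq> {n0..}" for S using that n0(1) by auto
  have inU: "twist (angle S) \<in> U" if "S \<subseteq> {n0..}" for S
    using n0(2)[OF that] twist_Poiss[OF admissible_angle[OF S5[OF that]] disk_coeff_rot[OF S5[OF that]]]
    by (simp add: V(2) P_def)
  have top: "twist (angle S) \<in> topspace ?X" if "S \<subseteq> {n0..}" for S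
    using inU[OF that] openin_subset[OF U(1)] by blast
  let ?f = "\<lambda>S. path_component_of_set ?X (twist (angle S))"
  \<comment> \<open>Every subset of \<open>{n0..}\<close> has its own path component, and all these
    components meet \<open>N\<close>.\<close>
  have "inj_on ?f (Pow {n0..})"
  proof (rule inj_onI)
    fix S T assume S: "S \<in> Pow {n0..}" and T: "T \<in> Pow {n0..}" and eq: "?f S = ?f T"
    have "twist (angle T) \<in> ?f S"
      unfolding eq using top[of T] T by (simp add: path_component_of_refl)
    then have "path_component_of ?X (twist (angle S)) (twist (angle T))" by simp
    then show "S = T"
      using S T unfolding P_def by (intro path_component_twist_inj S5) auto
  qed
  then have "uncountable (?f ` Pow {n0..})"
    using uncountable_Pow_atLeast countable_image_inj_on by blast
  moreover have "?f ` Pow {n0..} \<subseteq> {C \<in> path_components_of ?X. C \<inter> N \<noteq> {}}"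
  proof
    fix C assume "C \<in> ?f ` Pow {n0..}"
    then obtain S where S: "S \<subseteq> {n0..}" "C = ?f S" by auto
    have "twist (angle S) \<in> C \<inter> N"
      using S top[OF S(1)] inU[OF S(1)] U(3) by (auto simp: path_component_of_refl)
    moreover have "C \<in> path_components_of ?X"
      using S top[OF S(1)] by (auto simp: path_components_of_def)
    ultimately show "C \<in> {C \<in> path_components_of ?X. C \<inter> N \<noteq> {}}" by blast
  qed
  ultimately show ?thesis
    using countable_subset by blast
qed

end
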